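(* Let a nice group $\mathbb{G}$ act measurably on Polish spaces $\Omega_1$ and $\Omega_2$, let $P_1$ and $P_2$ be $\mathbb{G}$-invariant probability measures on $\Omega_1$ and $\Omega_2$, respectively, and let $P\in\Lambda_{\mathbb{G}}$. Then the following are equivalent: (i) $P$ is an extreme point of $\Lambda_{\mathbb{G}}$. (ii) The set $\{g_1+g_2\,|\,g_i\in\mathbf{L}_1(\Sigma_i,P_i)\}$ is norm-dense in $\mathbf{L}_1(\Sigma,P)$. (iii) There is no non-zero $f\in\mathbf{L}_\infty(\Sigma,P)$ such that $$\int(g_1+g_2)f\,dP\;=\;0\qquad\text{for all }g_i\in\mathbf{L}_1(\Sigma_i,P_i),\;i=1,2.$$ (iv) There is no non-zero $f\in\mathbf{L}_\infty(\Sigma,P)$ such that, for $(\xi_1,\xi_2)\sim P$, $$\mathbb{E}[f(\xi_1,\xi_2)\,|\,\xi_1]\;=\;0\;=\;\mathbb{E}[f(\xi_1,\xi_2)\,|\,\xi_2]\qquad\text{almost surely.}$$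
   Context: A topological group is nice if its topology is locally compact and Polish. An action is measurable if it is jointly measurable. A measure $\mu$ is $\mathbb{G}$-invariant if $\phi_*\mu:=\mu\circ\phi^{-1}=\mu$ for all $\phi\in\mathbb{G}$. $\mathbb{G}$ acts on $\Omega:=\Omega_1\times\Omega_2$ by $(\phi\otimes\phi)(\omega_1,\omega_2)=(\phi\omega_1,\phi\omega_2)$. $\Lambda=\Lambda(P_1,P_2)$ is the set of couplings of $P_1$ and $P_2$, i.e. of probability measures on $\Omega$ with marginals $P_1$ and $P_2$, and $\Lambda_{\mathbb{G}}:=\{P\in\Lambda\,|\,(\phi\otimes\phi)_*P=P\text{ for all }\phi\in\mathbb{G}\}$. $\Sigma$ is the $\sigma$-algebra of $\mathbb{G}$-invariant Borel sets in $\Omega$, and $\Sigma_i$ that of $\mathbb{G}$-invariant Borel sets in $\Omega_i$. $\mathbf{L}_p(\Sigma,P)$ is the space of elements of $\mathbf{L}_p(P)$ that contain a $\Sigma$-measurable (equivalently, $\mathbb{G}$-invariant measurable) function, and similarly for $\mathbf{L}_p(\Sigma_i,P_i)$. In $g_1+g_2$, the function $g_i$ is regarded as a function on $\Omega$ via $(\omega_1,\omega_2)\mapsto g_i(\omega_i)$. *)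

theory Defs
  imports "HOL-Probability.Probability"
begin

text \<open>
  Groups are written additively: \<^class>\<open>group_add\<close> does not assume commutativity, and
  \<^class>\<open>topological_group_add\<close> is the library's class of topological groups.
  The neutral element is therefore \<open>0\<close> and the product of \<open>g\<close> and \<open>h\<close> is \<open>g + h\<close>.
\<close>

definition measurable_action ::
    "('g::{topological_group_add, polish_space} \<Rightarrow> 'x::polish_space \<Rightarrow> 'x) \<Rightarrow> bool" where
  "measurable_action \<alpha> \<longleftrightarrow>
     (\<forall>x. \<alpha> 0 x = x) \<and>
     (\<forall>g h x. \<alpha> (g + h) x = \<alpha> g (\<alpha> h x)) \<and>
     (\<lambda>(g, x). \<alpha> g x) \<in> borel \<Otimes>\<^sub>M borel \<rightarrow>\<^sub>M borel"

definition diagonal_action :: "('g \<Rightarrow> 'a \<Rightarrow> 'a) \<Rightarrow> ('g \<Rightarrow> 'b \<Rightarrow> 'b) \<Rightarrow> 'g \<Rightarrow> 'a \<times> 'b \<Rightarrow> 'a \<times> 'b" where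
  "diagonal_action \<alpha>\<^sub>1 \<alpha>\<^sub>2 g = (\<lambda>(x, y). (\<alpha>\<^sub>1 g x, \<alpha>\<^sub>2 g y))"

definition invariant_measure :: "('g \<Rightarrow> 'x::topological_space \<Rightarrow> 'x) \<Rightarrow> 'x measure \<Rightarrow> bool" where
  "invariant_measure \<alpha> M \<longleftrightarrow> (\<forall>g. distr M borel (\<alpha> g) = M)"

definition invariant_algebra :: "('g \<Rightarrow> 'x::topological_space \<Rightarrow> 'x) \<Rightarrow> 'x measure" where
  "invariant_algebra \<alpha> = sigma UNIV {A \<in> sets borel. \<forall>g. \<alpha> g -` A = A}"

lemma space_invariant_algebra [simp]: "space (invariant_algebra \<alpha>) = UNIV"
  by (simp add: invariant_algebra_def space_measure_of_conv)

lemma sets_invariant_algebra: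
  fixes \<alpha> :: "'g \<Rightarrow> 'x::topological_space \<Rightarrow> 'x"
  shows "sets (invariant_algebra \<alpha>) = {A \<in> sets borel. \<forall>g. \<alpha> g -` A = A}" (is "_ = ?S")
proof -
  have "sigma_algebra UNIV ?S"
    unfolding sigma_algebra_iff2
  proof (intro conjI ballI allI impI)
    fix A :: "nat \<Rightarrow> 'x set" assume A: "range A \<subseteq> ?S"
    then have "\<alpha> g -` A i = A i" for g i
      by blast
    moreover have "\<Union> (range A) \<in> sets borel"
      using A by (intro sets.countable_UN) blast
    ultimately show "\<Union> (range A) \<in> ?S"
      by (simp add: vimage_UN)
  qed (auto simp: vimage_Diff)
  then show ?thesis
    by (simp add: invariant_algebra_def sigma_algebra.sigma_sets_eq)
qed

definition couplings ::
    "'a::topological_space measure \<Rightarrow> 'b::topological_space measure \<Rightarrow> ('a \<times> 'b) measure set" where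
  "couplings P\<^sub>1 P\<^sub>2 =
     {P. prob_space P \<and> sets P = sets borel \<and> distr P borel fst = P\<^sub>1 \<and> distr P borel snd = P\<^sub>2}"

definition invariant_couplings ::
    "('g \<Rightarrow> 'a::topological_space \<Rightarrow> 'a) \<Rightarrow> ('g \<Rightarrow> 'b::topological_space \<Rightarrow> 'b) \<Rightarrow>
      'a measure \<Rightarrow> 'b measure \<Rightarrow> ('a \<times> 'b) measure set" where
  "invariant_couplings \<alpha>\<^sub>1 \<alpha>\<^sub>2 P\<^sub>1 P\<^sub>2 =
     {P \<in> couplings P\<^sub>1 P\<^sub>2. invariant_measure (diagonal_action \<alpha>\<^sub>1 \<alpha>\<^sub>2) P}"

text \<open>
  The type of measures is not a \<^class>\<open>real_vector\<close>, so the library's \<^const>\<open>extreme_point_of\<close>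
  does not apply. The following is its definition for sets \<open>K\<close> of finite measures on a common
  \<open>\<sigma>\<close>-algebra, with convex combinations of measures taken setwise.
\<close>

definition extreme_measure_of :: "'x measure \<Rightarrow> 'x measure set \<Rightarrow> bool" where
  "extreme_measure_of P K \<longleftrightarrow> P \<in> K \<and>
     \<not> (\<exists>Q\<in>K. \<exists>R\<in>K. Q \<noteq> R \<and>
          (\<exists>t. 0 < t \<and> t < 1 \<and>
            (\<forall>A\<in>sets P. measure P A = (1 - t) * measure Q A + t * measure R A)))"

text \<open>
  Elements of \<open>L\<^sub>p\<close> are represented by functions, without forming the quotient modulo almost sure
  equality; in particular \<open>f\<close> is the zero element iff \<open>f = 0\<close> almost everywhere.
  In \<open>L1_on F M\<close> and \<open>Linf_on F M\<close>, the measure \<open>F\<close> only serves as a sub-\<open>\<sigma>\<close>-algebra of \<open>M\<close>;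
  membership means that the class of \<open>f\<close> contains an \<open>F\<close>-measurable function.
\<close>

definition L1_on :: "'x measure \<Rightarrow> 'x measure \<Rightarrow> ('x \<Rightarrow> real) set" where
  "L1_on F M =
     {f. integrable M f \<and> (\<exists>f'\<in>borel_measurable F. AE x in M. f x = f' x)}"

definition Linf_on :: "'x measure \<Rightarrow> 'x measure \<Rightarrow> ('x \<Rightarrow> real) set" where
  "Linf_on F M =
     {f \<in> borel_measurable M. (\<exists>C. AE x in M. \<bar>f x\<bar> \<le> C) \<and>
        (\<exists>f'\<in>borel_measurable F. AE x in M. f x = f' x)}"

definition L1_dense_in :: "'x measure \<Rightarrow> ('x \<Rightarrow> real) set \<Rightarrow> ('x \<Rightarrow> real) set \<Rightarrow> bool" where
  "L1_dense_in M D S \<longleftrightarrow>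
     D \<subseteq> S \<and> (\<forall>f\<in>S. \<forall>\<epsilon>>0. \<exists>d\<in>D. (\<integral>x. \<bar>f x - d x\<bar> \<partial>M) < \<epsilon>)"

end

theory Submission
  imports Defs
begin

text \<open>
  The proof combines a convexity argument in the style of Douglas and Lindenstrauss with a statement
  about the group.

  \<^bold>\<open>Convexity.\<close> If \<open>P\<close> is a proper convex combination of invariant couplings \<open>Q\<close> and \<open>R\<close>, then \<open>Q\<close>
  is dominated by a multiple of \<open>P\<close>, so \<open>Q = h P\<close> with \<open>h\<close> bounded, and \<open>f = h - 1\<close> is such that the
  signed measure \<open>f P\<close> has null marginals, because \<open>P\<close> and \<open>Q\<close> have the same ones. Conversely, if \<open>f\<close>
  is invariant, \<open>\<bar>f\<bar> \<le> c\<close>, and \<open>f P\<close> has null marginals, then \<open>P\<close> is the midpoint of the invariant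
  couplings \<open>(1 + f/c) P\<close> and \<open>(1 - f/c) P\<close>. Hence \<open>P\<close> is extreme iff a bounded invariant \<open>f\<close> for
  which \<open>f P\<close> has null marginals vanishes almost everywhere
  (\<open>extreme_iff_null_marginals_trivial\<close>). That \<open>f P\<close> has null marginals is just what the two
  conditional expectations say (\<open>cond_exp_iff_null_marginals\<close>). It is also equivalent to
  orthogonality of \<open>f\<close> to the sums \<open>g\<^sub>1 + g\<^sub>2\<close> of invariant functions
  (\<open>orthogonal_to_sums_iff_null_marginals\<close>), and the absence of a non-zero bounded \<open>f\<close> of this kind
  means density of the sums, by the Hahn-Banach theorem and the duality of \<open>L\<^sub>1\<close> and \<open>L\<^sub>\<infinity>\<close>
  (\<open>L1_annihilator_exists\<close>); conditioning on the invariant \<open>\<sigma>\<close>-algebra makes the annihilating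
  function invariant.

  \<^bold>\<open>The group.\<close> Two steps above are not formal. The density \<open>h\<close> of one invariant measure with respect
  to another is at first invariant only up to a null set that depends on the group element. And
  orthogonality to \<^emph>\<open>invariant\<close> functions of one coordinate says only that the marginals of
  \<open>(1 + f/c) P\<close> and \<open>P\<close> agree on invariant sets, whereas they have to be equal. Both gaps are closed
  by \<open>invariant_version_exists\<close>: an almost invariant Borel function \<open>h\<close> has a strictly invariant
  version, whose value at \<open>x\<close> is the almost sure value of \<open>g \<mapsto> h (g x)\<close> if this function is almost
  surely constant, and \<open>0\<close> otherwise. For this to be invariant in \<open>x\<close>, the null sets on the group must
  be stable under right translations, which is where local compactness enters: they can be taken to
  be those of a right Haar measure (\<open>exists_right_haar_measure\<close>). That measure is obtained by Haar's
  covering numbers and Halmos's extension of a content from compact sets to Borel sets.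
\<close>

section \<open>Borel measures from contents on compact sets\<close>

text \<open>
  This is what makes contents subadditive on open sets. The disjoint closed sets \<open>K - U\<close> and \<open>K - W\<close>
  have disjoint open neighbourhoods; removing one or the other from \<open>K\<close> leaves the two pieces.
\<close>

lemma compact_subset_Un_split:
  fixes K :: "'a::t4_space set"
  assumes "compact K" "open U" "open W" "K \<subseteq> U \<union> W"
  obtains K1 K2 where "compact K1" "compact K2" "K1 \<subseteq> U" "K2 \<subseteq> W" "K = K1 \<union> K2"
proof -
  have "compact (K - U)" "compact (K - W)" "(K - U) \<inter> (K - W) = {}"
    using assms by (auto intro: compact_diff)
  then obtain S T where ST: "open S" "open T" "K - U \<subseteq> S" "K - W \<subseteq> T" "S \<inter> T = {}"
    using t4_space compact_imp_closed by metis
  then have "compact (K - S)" "compact (K - T)" "K = (K - S) \<union> (K - T)"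
    using \<open>compact K\<close> by (auto intro!: compact_diff)
  moreover have "K - S \<subseteq> U" "K - T \<subseteq> W"
    using ST by auto
  ultimately show ?thesis using that by blast
qed

text \<open>
  A content in the sense of Halmos, except that infinite values are admitted. It is extended to open
  sets from within and then to arbitrary sets from outside; the result is an outer measure for which
  all Borel sets are measurable.
\<close>

locale compact_content =
  fixes c :: "'a::t4_space set \<Rightarrow> ennreal"
  assumes empty: "c {} = 0"
    and mono: "compact K \<Longrightarrow> compact L \<Longrightarrow> K \<subseteq> L \<Longrightarrow> c K \<le> c L"
    and subadditive: "compact K \<Longrightarrow> compact L \<Longrightarrow> c (K \<union> L) \<le> c K + c L"
    and additive: "compact K \<Longrightarrow> compact L \<Longrightarrow> K \<inter> L = {} \<Longrightarrow> c (K \<union> L) = c K + c L"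
begin

definition open_content :: "'a set \<Rightarrow> ennreal" where
  "open_content U = (SUP K\<in>{K. compact K \<and> K \<subseteq> U}. c K)"

definition outer_content :: "'a set \<Rightarrow> ennreal" where
  "outer_content A = (INF U\<in>{U. open U \<and> A \<subseteq> U}. open_content U)"

lemma content_le_open_content: "compact K \<Longrightarrow> K \<subseteq> U \<Longrightarrow> c K \<le> open_content U"
  unfolding open_content_def by (rule SUP_upper) auto

lemma open_content_leI: "(\<And>K. compact K \<Longrightarrow> K \<subseteq> U \<Longrightarrow> c K \<le> x) \<Longrightarrow> open_content U \<le> x"
  unfolding open_content_def by (rule SUP_least) auto

lemma outer_content_le_open_content: "open U \<Longrightarrow> A \<subseteq> U \<Longrightarrow> outer_content A \<le> open_content U"
  unfolding outer_content_def by (rule INF_lower) auto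

lemma outer_content_geI: "(\<And>U. open U \<Longrightarrow> A \<subseteq> U \<Longrightarrow> x \<le> open_content U) \<Longrightarrow> x \<le> outer_content A"
  unfolding outer_content_def by (rule INF_greatest) auto

lemma open_content_mono: "U \<subseteq> W \<Longrightarrow> open_content U \<le> open_content W"
  by (rule open_content_leI, rule content_le_open_content) auto

lemma outer_content_mono: "A \<subseteq> B \<Longrightarrow> outer_content A \<le> outer_content B"
  by (rule outer_content_geI, rule outer_content_le_open_content) auto

lemma content_le_outer_content: "compact K \<Longrightarrow> c K \<le> outer_content K"
  by (rule outer_content_geI, rule content_le_open_content)

lemma outer_content_open: "open U \<Longrightarrow> outer_content U = open_content U"
  by (intro antisym outer_content_le_open_content outer_content_geI open_content_mono) auto

lemma outer_content_empty: "outer_content {} = 0"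
proof -
  have "outer_content {} \<le> open_content {}" by (rule outer_content_le_open_content) auto
  also have "\<dots> \<le> 0" by (rule open_content_leI) (auto simp: empty)
  finally show ?thesis by simp
qed

lemma content_finite_UN_le:
  fixes U :: "nat \<Rightarrow> 'a set"
  assumes "compact K" "K \<subseteq> (\<Union>i<n. U i)" "\<And>i. i < n \<Longrightarrow> open (U i)"
  shows "c K \<le> (\<Sum>i<n. open_content (U i))"
  using assms
proof (induction n arbitrary: K)
  case 0
  then show ?case by (simp add: empty)
next
  case (Suc n)
  have *: "K \<subseteq> (\<Union>i<n. U i) \<union> U n" using Suc.prems(2) by (simp add: lessThan_Suc Un_commute)
  have "open (\<Union>i<n. U i)" "open (U n)" using Suc.prems(3) by auto
  from compact_subset_Un_split[OF Suc.prems(1) this *]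
  obtain K1 K2 where K: "compact K1" "compact K2" "K1 \<subseteq> (\<Union>i<n. U i)" "K2 \<subseteq> U n" "K = K1 \<union> K2" .
  have "c K \<le> c K1 + c K2" using K by (simp add: subadditive)
  also have "\<dots> \<le> (\<Sum>i<n. open_content (U i)) + open_content (U n)"
    using Suc.IH[OF K(1,3)] Suc.prems(3) content_le_open_content[OF K(2,4)] by (intro add_mono) auto
  finally show ?case by simp
qed

lemma open_content_UN_le:
  fixes U :: "nat \<Rightarrow> 'a set"
  assumes "\<And>i. open (U i)"
  shows "open_content (\<Union>i. U i) \<le> (\<Sum>i. open_content (U i))"
proof (rule open_content_leI)
  fix K assume K: "compact K" "K \<subseteq> (\<Union>i. U i)"
  obtain I where I: "finite I" "K \<subseteq> (\<Union>i\<in>I. U i)"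
    using compactE_image[OF K(1), of UNIV U] assms K(2) by auto
  obtain n where "I \<subseteq> {..<n}" using finite_nat_iff_bounded I(1) by blast
  with I(2) have "K \<subseteq> (\<Union>i<n. U i)" by blast
  then have "c K \<le> (\<Sum>i<n. open_content (U i))"
    by (rule content_finite_UN_le[OF K(1)]) (rule assms)
  also have "\<dots> \<le> (\<Sum>i. open_content (U i))" by (intro sum_le_suminf) auto
  finally show "c K \<le> (\<Sum>i. open_content (U i))" .
qed

text \<open>
  Open supersets that are optimal up to \<open>e/2\<^sup>i\<^sup>+\<^sup>1\<close> reduce this to open sets, where compactness reduces
  countable covers to finite ones.
\<close>

lemma outer_content_UN_le:
  fixes A :: "nat \<Rightarrow> 'a set"
  shows "outer_content (\<Union>i. A i) \<le> (\<Sum>i. outer_content (A i))"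
proof (cases "\<exists>i. outer_content (A i) = top")
  case True
  then obtain i where "outer_content (A i) = top" by blast
  moreover have "(\<Sum>j\<in>{i}. outer_content (A j)) \<le> (\<Sum>j. outer_content (A j))"
    by (rule sum_le_suminf) auto
  ultimately show ?thesis by (simp add: top_unique)
next
  case False
  show ?thesis
  proof (rule ennreal_le_epsilon)
    fix e :: real assume e: "0 < e"
    have "\<exists>U. open U \<and> A i \<subseteq> U \<and> open_content U \<le> outer_content (A i) + ennreal (e * (1/2)^Suc i)" for i
    proof (rule ccontr)
      assume "\<not> ?thesis"
      then have "outer_content (A i) + ennreal (e * (1/2)^Suc i) \<le> outer_content (A i)"
        by (intro outer_content_geI) (meson nle_le)
      then have "outer_content (A i) + ennreal (e * (1/2)^Suc i) \<le> outer_content (A i) + 0"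
        by simp
      moreover have "e * (1/2)^Suc i > 0" using e by simp
      ultimately show False using False
        unfolding ennreal_add_left_cancel_le ennreal_eq_0_iff le_zero_eq infinity_ennreal_def
        by (metis not_le)
    qed
    then obtain U where U: "\<And>i. open (U i)" "\<And>i. A i \<subseteq> U i"
      "\<And>i. open_content (U i) \<le> outer_content (A i) + ennreal (e * (1/2)^Suc i)" by metis
    have "outer_content (\<Union>i. A i) \<le> open_content (\<Union>i. U i)" using U by (intro outer_content_le_open_content) auto
    also have "\<dots> \<le> (\<Sum>i. open_content (U i))" by (rule open_content_UN_le) (rule U)
    also have "\<dots> \<le> (\<Sum>i. outer_content (A i) + ennreal (e * (1/2)^Suc i))"
      by (intro suminf_le U) auto
    also have "\<dots> = (\<Sum>i. outer_content (A i)) + (\<Sum>i. ennreal (e * (1/2)^Suc i))"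
      by (intro suminf_add[symmetric]) auto
    also have "(\<Sum>i. ennreal (e * (1/2)^Suc i)) = ennreal e"
      using sums_mult[OF power_half_series, of e] e by (intro suminf_ennreal_eq) auto
    finally show "outer_content (\<Union>i. A i) \<le> (\<Sum>i. outer_content (A i)) + ennreal e" .
  qed
qed

lemma outer_content_Un_le: "outer_content (A \<union> B) \<le> outer_content A + outer_content B"
proof -
  have "outer_content (\<Union>i. binaryset A B i) \<le> (\<Sum>i. outer_content (binaryset A B i))" by (rule outer_content_UN_le)
  then show ?thesis by (simp add: UN_binaryset_eq suminf_binaryset_eq outer_content_empty)
qed

lemma outer_measure_space_outer_content: "outer_measure_space (Pow UNIV) outer_content"
  unfolding outer_measure_space_def positive_def increasing_def countably_subadditive_def
  by (auto simp: outer_content_empty outer_content_mono outer_content_UN_le)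

text \<open>
  The main step towards Caratheodory's criterion. Approximate \<open>V \<inter> U\<close> from within by a compact set \<open>K\<close>
  and then the open set \<open>V - K\<close>, which contains \<open>V - U\<close>, by a compact set \<open>L\<close>. Since \<open>K\<close> and \<open>L\<close> are
  disjoint subsets of \<open>V\<close>, additivity of the content bounds the two contributions by that of \<open>V\<close>.
\<close>

lemma open_content_split:
  assumes "open V" "open U"
  shows "outer_content (V \<inter> U) + outer_content (V - U) \<le> open_content V"
proof -
  have *: "c K + outer_content (V - U) \<le> open_content V" if K: "compact K" "K \<subseteq> V \<inter> U" for K
  proof -
    have "outer_content (V - U) \<le> open_content (V - K)"
      using K assms compact_imp_closed[OF K(1)] by (intro outer_content_le_open_content) (auto intro: open_Diff)
    then have "c K + outer_content (V - U) \<le> c K + open_content (V - K)" by (rule add_left_mono)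
    also have "\<dots> = (SUP L\<in>{L. compact L \<and> L \<subseteq> V - K}. c K + c L)"
      unfolding open_content_def by (rule ennreal_SUP_add_right) (auto intro: exI[of _ "{}"])
    also have "\<dots> \<le> open_content V"
    proof (rule SUP_least)
      fix L assume "L \<in> {L. compact L \<and> L \<subseteq> V - K}"
      then have L: "compact L" "L \<subseteq> V - K" by auto
      then have "c K + c L = c (K \<union> L)" using K by (intro additive[symmetric]) auto
      also have "\<dots> \<le> open_content V" using K L by (intro content_le_open_content) auto
      finally show "c K + c L \<le> open_content V" .
    qed
    finally show ?thesis .
  qed
  have "outer_content (V \<inter> U) + outer_content (V - U) \<le> open_content (V \<inter> U) + outer_content (V - U)"
    using assms by (intro add_right_mono outer_content_le_open_content) auto
  also have "\<dots> = (SUP K\<in>{K. compact K \<and> K \<subseteq> V \<inter> U}. c K + outer_content (V - U))"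
    unfolding open_content_def by (rule ennreal_SUP_add_left[symmetric]) auto
  also have "\<dots> \<le> open_content V" by (rule SUP_least) (use * in auto)
  finally show ?thesis .
qed

lemma open_lambda_system:
  assumes "open U"
  shows "U \<in> lambda_system UNIV (Pow UNIV) outer_content"
proof -
  have "outer_content (U \<inter> A) + outer_content ((UNIV - U) \<inter> A) = outer_content A" for A
  proof (rule antisym)
    show "outer_content (U \<inter> A) + outer_content ((UNIV - U) \<inter> A) \<le> outer_content A"
    proof (rule outer_content_geI)
      fix V assume V: "open V" "A \<subseteq> V"
      have "outer_content (U \<inter> A) + outer_content ((UNIV - U) \<inter> A) \<le> outer_content (V \<inter> U) + outer_content (V - U)"
        using V by (intro add_mono outer_content_mono) auto
      also have "\<dots> \<le> open_content V" using V assms by (intro open_content_split)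
      finally show "outer_content (U \<inter> A) + outer_content ((UNIV - U) \<inter> A) \<le> open_content V" .
    qed
    have "A = (U \<inter> A) \<union> ((UNIV - U) \<inter> A)" by auto
    then show "outer_content A \<le> outer_content (U \<inter> A) + outer_content ((UNIV - U) \<inter> A)" by (metis outer_content_Un_le)
  qed
  then show ?thesis unfolding lambda_system_def by auto
qed

definition borel_extension :: "'a measure" where
  "borel_extension = measure_of UNIV (sets borel) outer_content"

lemma sets_borel_extension [simp]: "sets borel_extension = sets borel"
  unfolding borel_extension_def using sets.sigma_sets_eq[of borel] by simp

lemma emeasure_borel_extension:
  assumes "A \<in> sets borel"
  shows "emeasure borel_extension A = outer_content A"
proof -
  interpret sigma_algebra "UNIV :: 'a set" "Pow UNIV" by (rule sigma_algebra_Pow)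
  have ms: "measure_space UNIV (lambda_system UNIV (Pow UNIV) outer_content) outer_content"
    by (rule caratheodory_lemma[OF outer_measure_space_outer_content])
  then interpret L: sigma_algebra UNIV "lambda_system UNIV (Pow UNIV) outer_content"
    by (simp add: measure_space_def)
  have "sets borel \<subseteq> lambda_system UNIV (Pow UNIV) outer_content"
    using open_lambda_system L.sigma_sets_subset[of "{S. open S}"] unfolding sets_borel by blast
  then have "measure_space UNIV (sets borel) outer_content"
    using ms sets.sigma_algebra_axioms[of "borel :: 'a measure"] by (auto intro: measure_down)
  then show ?thesis
    using assms unfolding borel_extension_def measure_space_def
    by (intro emeasure_measure_of_sigma) auto
qed

end

section \<open>Haar measure on locally compact groups\<close>

text \<open>
  By Tychonoff's theorem the sequence of functions \<open>f n\<close> has a cluster point in a product of compact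
  intervals; the indices at which \<open>f n\<close> is close to it form the filter. A filter in place of a
  subsequence allows for uncountably many coordinates, and it still transports identities and weak
  inequalities to the limit.
\<close>

lemma exists_simultaneous_limit:
  fixes f :: "nat \<Rightarrow> 'i \<Rightarrow> real"
  assumes "\<And>n i. \<bar>f n i\<bar> \<le> b i"
  obtains F l where "F \<noteq> bot" "F \<le> sequentially" "\<And>i. ((\<lambda>n. f n i) \<longlongrightarrow> l i) F"
proof -
  have "compactin (product_topology (\<lambda>i. euclidean) UNIV) (PiE UNIV (\<lambda>i. {- b i..b i}))"
    unfolding compactin_PiE by simp
  then have K: "compact (PiE UNIV (\<lambda>i. {- b i..b i}))"
    by (simp add: euclidean_product_topology)
  have "filtermap f sequentially \<noteq> bot" by (simp add: filtermap_bot_iff)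
  moreover have "eventually (\<lambda>x. x \<in> PiE UNIV (\<lambda>i. {- b i..b i})) (filtermap f sequentially)"
    using assms by (auto simp: eventually_filtermap PiE_def Pi_def abs_le_iff minus_le_iff)
  ultimately obtain l where l: "inf (nhds l) (filtermap f sequentially) \<noteq> bot"
    using K unfolding compact_filter by blast
  let ?F = "inf sequentially (filtercomap f (nhds l))"
  have "?F \<noteq> bot"
  proof
    assume "?F = bot"
    then have "eventually (\<lambda>_. False) ?F" by simp
    then obtain Q R where QR: "eventually Q sequentially" "eventually R (nhds l)"
      "\<And>n. Q n \<Longrightarrow> R (f n) \<Longrightarrow> False"
      unfolding eventually_inf eventually_filtercomap by blast
    have "eventually (\<lambda>x. \<not> R x) (filtermap f sequentially)"
      unfolding eventually_filtermap by (rule eventually_mono[OF QR(1)]) (use QR(3) in blast)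
    with QR(2) have "eventually (\<lambda>_. False) (inf (nhds l) (filtermap f sequentially))"
      unfolding eventually_inf by blast
    then show False using l by (simp add: trivial_limit_def)
  qed
  moreover have "(f \<longlongrightarrow> l) ?F"
    by (metis filterlim_filtercomap filterlim_mono inf_le2 order_refl)
  then have "((\<lambda>n. f n i) \<longlongrightarrow> l i) ?F" for i
    by (rule continuous_on_tendsto_compose[OF continuous_on_product_coordinates]) auto
  ultimately show ?thesis using that[of ?F l] by simp
qed

text \<open>
  Haar's index \<open>(K : V)\<close>. It is meaningful when \<open>K\<close> is compact and \<open>V\<close> is an open neighbourhood of the
  neutral element, as finite covers then exist. Covering by right translates makes it invariant under
  right translations of \<open>K\<close>.
\<close>

definition cover_number :: "'g::topological_group_add set \<Rightarrow> 'g set \<Rightarrow> nat" where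
  "cover_number V K = (LEAST n. \<exists>F. finite F \<and> card F = n \<and> K \<subseteq> (\<Union>g\<in>F. (\<lambda>v. v + g) ` V))"

lemma right_translation_vimage:
  fixes A :: "'g::group_add set"
  shows "(\<lambda>x. x + g) -` A = (\<lambda>x. x + - g) ` A"
proof (intro set_eqI iffI)
  fix x assume "x \<in> (\<lambda>x. x + g) -` A"
  then have "x + g \<in> A" "x = x + g + - g" by (auto simp: add.assoc)
  then show "x \<in> (\<lambda>x. x + - g) ` A" by blast
qed (auto simp: add.assoc)

lemma open_right_translation:
  fixes V :: "'g::topological_group_add set"
  assumes "open V"
  shows "open ((\<lambda>v. v + g) ` V)"
proof -
  have "open ((\<lambda>x. x + - g) -` V)"
    by (rule open_vimage[OF assms]) (intro continuous_intros)
  then show ?thesis by (simp only: right_translation_vimage minus_minus)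
qed

lemma compact_right_translation:
  fixes K :: "'g::topological_group_add set"
  assumes "compact K"
  shows "compact ((\<lambda>v. v + g) ` K)"
  by (rule compact_continuous_image) (auto intro!: continuous_intros assms)

lemma finite_right_cover_exists:
  fixes V :: "'g::topological_group_add set"
  assumes "open V" "0 \<in> V" "compact K"
  obtains F where "finite F" "F \<subseteq> K" "K \<subseteq> (\<Union>g\<in>F. (\<lambda>v. v + g) ` V)"
proof -
  have "K \<subseteq> (\<Union>g\<in>K. (\<lambda>v. v + g) ` V)"
    using \<open>0 \<in> V\<close> by force
  then show ?thesis
    using compactE_image[OF \<open>compact K\<close>, of K "\<lambda>g. (\<lambda>v. v + g) ` V"]
      open_right_translation[OF \<open>open V\<close>] that by metis
qed

lemma cover_number_le:
  assumes "finite F" "K \<subseteq> (\<Union>g\<in>F. (\<lambda>v. v + g) ` V)"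
  shows "cover_number V K \<le> card F"
  unfolding cover_number_def by (rule Least_le) (use assms in auto)

lemma cover_number_attained:
  fixes V :: "'g::topological_group_add set"
  assumes "open V" "0 \<in> V" "compact K"
  obtains F where "finite F" "card F = cover_number V K" "K \<subseteq> (\<Union>g\<in>F. (\<lambda>v. v + g) ` V)"
proof -
  have "\<exists>F. finite F \<and> card F = cover_number V K \<and> K \<subseteq> (\<Union>g\<in>F. (\<lambda>v. v + g) ` V)"
    unfolding cover_number_def
    by (rule LeastI_ex) (metis finite_right_cover_exists[OF assms])
  then show ?thesis using that by blast
qed

lemma cover_number_empty: "cover_number V {} = 0"
  using cover_number_le[of "{}" "{}" V] by simp

lemma cover_number_mono:
  fixes V :: "'g::topological_group_add set"
  assumes "open V" "0 \<in> V" "compact L" "K \<subseteq> L"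
  shows "cover_number V K \<le> cover_number V L"
proof -
  obtain F where "finite F" "card F = cover_number V L" "L \<subseteq> (\<Union>g\<in>F. (\<lambda>v. v + g) ` V)"
    using cover_number_attained[OF assms(1-3)] .
  then show ?thesis using assms(4) by (metis cover_number_le order_trans)
qed

lemma cover_number_Un_le:
  fixes V :: "'g::topological_group_add set"
  assumes "open V" "0 \<in> V" "compact K" "compact L"
  shows "cover_number V (K \<union> L) \<le> cover_number V K + cover_number V L"
proof -
  obtain F where F: "finite F" "card F = cover_number V K" "K \<subseteq> (\<Union>g\<in>F. (\<lambda>v. v + g) ` V)"
    using cover_number_attained[OF assms(1,2,3)] .
  obtain G where G: "finite G" "card G = cover_number V L" "L \<subseteq> (\<Union>g\<in>G. (\<lambda>v. v + g) ` V)"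
    using cover_number_attained[OF assms(1,2,4)] .
  have "cover_number V (K \<union> L) \<le> card (F \<union> G)"
    using F G by (intro cover_number_le) auto
  also have "\<dots> \<le> card F + card G" by (rule card_Un_le)
  finally show ?thesis using F G by simp
qed

text \<open>
  Each translate in an optimal cover of \<open>K \<union> L\<close> helps to cover only one of the two sets, so the cover
  splits into a cover of \<open>K\<close> and a cover of \<open>L\<close>.
\<close>

lemma cover_number_Un_separated:
  fixes V :: "'g::topological_group_add set"
  assumes V: "open V" "0 \<in> V" and K: "compact K" "compact L"
    and sep: "\<And>g. (\<lambda>v. v + g) ` V \<inter> K = {} \<or> (\<lambda>v. v + g) ` V \<inter> L = {}"
  shows "cover_number V (K \<union> L) = cover_number V K + cover_number V L"
proof (rule antisym[OF cover_number_Un_le[OF V K]])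
  obtain F where F: "finite F" "card F = cover_number V (K \<union> L)"
    "K \<union> L \<subseteq> (\<Union>g\<in>F. (\<lambda>v. v + g) ` V)"
    using cover_number_attained[OF V compact_Un[OF K]] .
  let ?A = "{g\<in>F. (\<lambda>v. v + g) ` V \<inter> K \<noteq> {}}" and ?B = "{g\<in>F. (\<lambda>v. v + g) ` V \<inter> L \<noteq> {}}"
  have "K \<subseteq> (\<Union>g\<in>?A. (\<lambda>v. v + g) ` V)"
  proof
    fix x assume "x \<in> K"
    moreover from this obtain g where "g \<in> F" "x \<in> (\<lambda>v. v + g) ` V" using F(3) by blast
    ultimately show "x \<in> (\<Union>g\<in>?A. (\<lambda>v. v + g) ` V)" by blast
  qed
  then have "cover_number V K \<le> card ?A" using F(1) by (intro cover_number_le) auto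
  moreover have "L \<subseteq> (\<Union>g\<in>?B. (\<lambda>v. v + g) ` V)"
  proof
    fix x assume "x \<in> L"
    moreover from this obtain g where "g \<in> F" "x \<in> (\<lambda>v. v + g) ` V" using F(3) by blast
    ultimately show "x \<in> (\<Union>g\<in>?B. (\<lambda>v. v + g) ` V)" by blast
  qed
  then have "cover_number V L \<le> card ?B" using F(1) by (intro cover_number_le) auto
  moreover have "card ?A + card ?B = card (?A \<union> ?B)"
    using F(1) sep by (intro card_Un_disjoint[symmetric]) auto
  moreover have "\<dots> \<le> card F" using F(1) by (intro card_mono) auto
  ultimately show "cover_number V K + cover_number V L \<le> cover_number V (K \<union> L)"
    using F(2) by linarith
qed

lemma cover_number_right_translation_le:
  fixes V :: "'g::topological_group_add set"
  assumes "open V" "0 \<in> V" "compact K"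
  shows "cover_number V ((\<lambda>x. x + h) ` K) \<le> cover_number V K"
proof -
  obtain F where F: "finite F" "card F = cover_number V K" "K \<subseteq> (\<Union>g\<in>F. (\<lambda>v. v + g) ` V)"
    using cover_number_attained[OF assms] .
  have "(\<lambda>x. x + h) ` K \<subseteq> (\<Union>g\<in>(\<lambda>g. g + h) ` F. (\<lambda>v. v + g) ` V)"
    using F(3) by (force simp: add.assoc)
  then have "cover_number V ((\<lambda>x. x + h) ` K) \<le> card ((\<lambda>g. g + h) ` F)"
    using F(1) by (intro cover_number_le) auto
  also have "\<dots> \<le> card F" using F(1) by (rule card_image_le)
  finally show ?thesis using F(2) by simp
qed

lemma cover_number_right_translation:
  fixes V :: "'g::topological_group_add set"
  assumes "open V" "0 \<in> V" "compact K"
  shows "cover_number V ((\<lambda>x. x + h) ` K) = cover_number V K"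
proof (rule antisym[OF cover_number_right_translation_le[OF assms]])
  have "(\<lambda>x. x + - h) ` (\<lambda>x. x + h) ` K = K"
    by (simp add: image_image add.assoc)
  then show "cover_number V K \<le> cover_number V ((\<lambda>x. x + h) ` K)"
    using cover_number_right_translation_le[OF assms(1,2) compact_right_translation[OF assms(3)]]
    by metis
qed

text \<open>
  This bounds the ratio \<open>(K : V) / (C : V)\<close> independently of \<open>V\<close>: cover \<open>K\<close> by translates of \<open>U\<close>, enlarge
  them to translates of \<open>C\<close>, and cover each of these optimally by translates of \<open>V\<close>.
\<close>

lemma cover_number_le_mult:
  fixes V :: "'g::topological_group_add set"
  assumes V: "open V" "0 \<in> V" and U: "open U" "0 \<in> U" "U \<subseteq> C" "compact C" and K: "compact K"
  shows "cover_number V K \<le> cover_number U K * cover_number V C"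
proof -
  have *: "compact (\<Union>g\<in>F. (\<lambda>v. v + g) ` C) \<and>
      cover_number V (\<Union>g\<in>F. (\<lambda>v. v + g) ` C) \<le> card F * cover_number V C" if "finite F" for F
    using that
  proof (induction F)
    case empty
    then show ?case by (simp add: cover_number_empty)
  next
    case (insert g F)
    let ?T = "(\<lambda>v. v + g) ` C"
    have T: "compact ?T" using \<open>compact C\<close> by (rule compact_right_translation)
    have "cover_number V (?T \<union> (\<Union>g\<in>F. (\<lambda>v. v + g) ` C))
        \<le> cover_number V ?T + cover_number V (\<Union>g\<in>F. (\<lambda>v. v + g) ` C)"
      using insert.IH by (intro cover_number_Un_le V T) auto
    also have "\<dots> \<le> cover_number V C + card F * cover_number V C"
      using insert.IH by (simp add: cover_number_right_translation[OF V \<open>compact C\<close>])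
    finally show ?case using insert T by auto
  qed
  obtain F where F: "finite F" "card F = cover_number U K" "K \<subseteq> (\<Union>g\<in>F. (\<lambda>v. v + g) ` U)"
    using cover_number_attained[OF U(1,2) K] .
  have "K \<subseteq> (\<Union>g\<in>F. (\<lambda>v. v + g) ` C)" using F(3) U(3) by blast
  then have "cover_number V K \<le> cover_number V (\<Union>g\<in>F. (\<lambda>v. v + g) ` C)"
    using *[OF F(1)] by (intro cover_number_mono V) auto
  then show ?thesis using *[OF F(1)] F(2) by auto
qed

lemma cover_number_pos:
  fixes V :: "'g::topological_group_add set"
  assumes "open V" "0 \<in> V" "compact K" "K \<noteq> {}"
  shows "cover_number V K > 0"
proof (rule ccontr)
  assume "\<not> ?thesis"
  moreover obtain F where "finite F" "card F = cover_number V K" "K \<subseteq> (\<Union>g\<in>F. (\<lambda>v. v + g) ` V)"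
    using cover_number_attained[OF assms(1-3)] .
  ultimately show False using \<open>K \<noteq> {}\<close> by auto
qed

text \<open>
  If a translate of a small ball contains \<open>v + g \<in> K\<close> and \<open>w + g \<in> L\<close>, then \<open>v - w\<close> is a difference of
  elements of \<open>K\<close> and \<open>L\<close>. These differences form a compact set without \<open>0\<close>, while \<open>v - w\<close> is close
  to \<open>0\<close>.
\<close>

lemma eventually_translates_separate_compacts:
  fixes K L :: "'g::{topological_group_add, metric_space} set"
  assumes "compact K" "compact L" "K \<inter> L = {}"
  shows "eventually (\<lambda>n. \<forall>g. (\<lambda>v. v + g) ` ball 0 (inverse (Suc n)) \<inter> K = {} \<or>
      (\<lambda>v. v + g) ` ball 0 (inverse (Suc n)) \<inter> L = {}) sequentially"
proof -
  have cont: "continuous_on UNIV (\<lambda>p::'g \<times> 'g. fst p - snd p)"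
    by (intro continuous_intros)
  have "compact ((\<lambda>p. fst p - snd p) ` (K \<times> L))"
    by (rule compact_continuous_image)
       (auto intro: continuous_on_subset[OF cont] compact_Times assms)
  then have "closed ((\<lambda>p. fst p - snd p) ` (K \<times> L))" by (rule compact_imp_closed)
  then have "open (- ((\<lambda>p. fst p - snd p) ` (K \<times> L)))" by (rule open_Compl)
  moreover have "(0::'g) - 0 \<in> - ((\<lambda>p. fst p - snd p) ` (K \<times> L))"
    using assms(3) by auto
  moreover have "((\<lambda>p::'g \<times> 'g. fst p - snd p) \<longlongrightarrow> 0 - 0) (nhds 0 \<times>\<^sub>F nhds 0)"
    by (intro tendsto_diff tendsto_fst tendsto_snd filterlim_fst filterlim_snd)
  ultimately have "eventually (\<lambda>p::'g\<times>'g. fst p - snd p \<in> - ((\<lambda>p. fst p - snd p) ` (K \<times> L)))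
      (nhds 0 \<times>\<^sub>F nhds 0)"
    using topological_tendstoD by blast
  then obtain A where A: "eventually A (nhds (0::'g))"
    "\<And>x y. A x \<Longrightarrow> A y \<Longrightarrow> x - y \<notin> (\<lambda>p. fst p - snd p) ` (K \<times> L)"
    unfolding eventually_prod_same by auto
  obtain e where e: "e > 0" "\<And>x. dist x 0 < e \<Longrightarrow> A x"
    using A(1) unfolding eventually_nhds_metric by blast
  have "eventually (\<lambda>n. inverse (real (Suc n)) < e) sequentially"
    using order_tendstoD(2)[OF LIMSEQ_inverse_real_of_nat e(1)] .
  then show ?thesis
  proof eventually_elim
    case (elim n)
    show ?case
    proof (rule allI, rule ccontr)
      fix g
      assume "\<not> ((\<lambda>v. v + g) ` ball 0 (inverse (Suc n)) \<inter> K = {} \<or>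
        (\<lambda>v. v + g) ` ball 0 (inverse (Suc n)) \<inter> L = {})"
      then obtain v w where vw: "dist 0 v < inverse (Suc n)" "v + g \<in> K"
        "dist 0 w < inverse (Suc n)" "w + g \<in> L" by auto
      then have "A v" "A w" using elim e(2) by (auto simp: dist_commute)
      moreover have "v - w = (v + g) - (w + g)"
        by (simp add: diff_conv_add_uminus minus_add add.assoc del: add_uminus_conv_diff)
      then have "v - w \<in> (\<lambda>p. fst p - snd p) ` (K \<times> L)"
        using vw(2,4) by (intro image_eqI[of _ _ "(v + g, w + g)"]) auto
      ultimately show False using A(2)[of v w] by blast
    qed
  qed
qed

text \<open>
  The content of \<open>K\<close> is a limit of the ratios \<open>(K : V) / (C : V)\<close> as \<open>V\<close> shrinks to the neutral element,
  where \<open>C\<close> is a fixed compact neighbourhood. Since \<open>C\<close> gets content \<open>1\<close>, the resulting measure is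
  non-zero and is finite on the interior of \<open>C\<close>.
\<close>

theorem exists_right_haar_measure:
  assumes "locally_compact_space (euclidean :: 'g::{topological_group_add, metric_space} topology)"
  obtains \<mu> :: "'g::{topological_group_add, metric_space} measure" and U :: "'g set"
  where "sets \<mu> = sets borel" "\<And>g. distr \<mu> borel (\<lambda>x. x + g) = \<mu>"
    "emeasure \<mu> UNIV \<noteq> 0" "open U" "0 \<in> U" "emeasure \<mu> U < \<infinity>"
proof -
  obtain U C :: "'g set" where UC: "open U" "compact C" "0 \<in> U" "U \<subseteq> C"
    using assms unfolding locally_compact_space_def by simp meson
  then have "C \<noteq> {}" by auto
  (* The metric need not be invariant under translations; it only matters that these
     neighbourhoods shrink to the neutral element. *)
  define V :: "nat \<Rightarrow> 'g set" where "V n = ball 0 (inverse (Suc n))" for n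
  have V: "open (V n)" "0 \<in> V n" for n unfolding V_def by auto
  have pos: "cover_number (V n) C > 0" for n
    using cover_number_pos[OF V UC(2) \<open>C \<noteq> {}\<close>] .
  define f where "f n K = (if compact K then cover_number (V n) K / cover_number (V n) C else 0 :: real)"
    for n K
  have bound: "\<bar>f n K\<bar> \<le> cover_number U K" for n K
  proof (cases "compact K")
    case True
    have "real (cover_number (V n) K) \<le> real (cover_number U K) * real (cover_number (V n) C)"
      unfolding of_nat_mult[symmetric] of_nat_le_iff by (rule cover_number_le_mult[OF V UC(1,3,4,2) True])
    then show ?thesis using pos[of n] True by (simp add: f_def divide_le_eq)
  qed (simp add: f_def)
  obtain F :: "nat filter" and l :: "'g set \<Rightarrow> real" where F: "F \<noteq> bot" "F \<le> sequentially" and l: "\<And>K. ((\<lambda>n. f n K) \<longlongrightarrow> l K) F"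
    using exists_simultaneous_limit[of f "\<lambda>K. real (cover_number U K)", OF bound] by blast
  have l_nonneg: "l K \<ge> 0" for K
    by (rule tendsto_lowerbound[OF l _ F(1)]) (simp add: f_def)
  have l_empty: "l {} = 0"
    using tendsto_unique[OF F(1) l[of "{}"]] by (simp add: f_def cover_number_empty)
  have l_mono: "l K \<le> l L" if "compact K" "compact L" "K \<subseteq> L" for K L
  proof (rule tendsto_le[OF F(1) l l], rule always_eventually, rule allI)
    fix n
    have "real (cover_number (V n) K) \<le> real (cover_number (V n) L)"
      unfolding of_nat_le_iff by (rule cover_number_mono[OF V that(2,3)])
    then show "f n K \<le> f n L" using that(1,2) by (simp add: f_def divide_right_mono)
  qed
  have l_sub: "l (K \<union> L) \<le> l K + l L" if "compact K" "compact L" for K L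
  proof (rule tendsto_le[OF F(1) tendsto_add[OF l l] l], rule always_eventually, rule allI)
    fix n
    have "real (cover_number (V n) (K \<union> L)) \<le> real (cover_number (V n) K) + real (cover_number (V n) L)"
      using cover_number_Un_le[OF V that] by (metis of_nat_add of_nat_le_iff)
    then show "f n (K \<union> L) \<le> f n K + f n L"
      using that by (simp add: f_def compact_Un add_divide_distrib[symmetric] divide_right_mono)
  qed
  have l_add: "l (K \<union> L) = l K + l L" if "compact K" "compact L" "K \<inter> L = {}" for K L
  proof (rule tendsto_unique[OF F(1) l])
    have "eventually (\<lambda>n. f n (K \<union> L) = f n K + f n L) sequentially"
      using eventually_translates_separate_compacts[OF that]
    proof eventually_elim
      case (elim n)
      then have "cover_number (V n) (K \<union> L) = cover_number (V n) K + cover_number (V n) L"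
        unfolding V_def[symmetric] by (intro cover_number_Un_separated V that) auto
      then show ?case using that by (simp add: f_def compact_Un add_divide_distrib)
    qed
    then have "eventually (\<lambda>n. f n K + f n L = f n (K \<union> L)) F"
      using F(2) by (auto simp: eq_commute intro: filter_leD)
    from tendsto_cong[OF this] tendsto_add[OF l l, of K L]
    show "((\<lambda>n. f n (K \<union> L)) \<longlongrightarrow> l K + l L) F" by simp
  qed
  have l_transl: "l ((\<lambda>x. x + g) ` K) = l K" if "compact K" for g K
    using that by (intro tendsto_unique[OF F(1) l])
      (use l[of K] in \<open>simp add: f_def compact_right_translation cover_number_right_translation[OF V]\<close>)
  have l_C: "l C = 1"
    using tendsto_unique[OF F(1) l[of C]] pos UC(2) by (simp add: f_def less_imp_neq[symmetric] del: neq0_conv)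
  interpret compact_content "\<lambda>K. ennreal (l K)"
  proof
    fix K L :: "'g set" assume *: "compact K" "compact L"
    show "ennreal (l (K \<union> L)) \<le> ennreal (l K) + ennreal (l L)"
      unfolding ennreal_plus[OF l_nonneg l_nonneg, symmetric] by (intro ennreal_leI l_sub *)
    show "ennreal (l K) \<le> ennreal (l L)" if "K \<subseteq> L"
      by (intro ennreal_leI l_mono * that)
    show "ennreal (l (K \<union> L)) = ennreal (l K) + ennreal (l L)" if "K \<inter> L = {}"
      unfolding ennreal_plus[OF l_nonneg l_nonneg, symmetric] l_add[OF * that] ..
  qed (simp add: l_empty)
  have open_transl: "open_content ((\<lambda>x. x + g) ` W) \<le> open_content W" for W g
  proof (rule open_content_leI)
    fix K assume K: "compact K" "K \<subseteq> (\<lambda>x. x + g) ` W"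
    have "(\<lambda>x. x + - g) ` K \<subseteq> W" using K(2) by (auto simp: add.assoc)
    then have "ennreal (l ((\<lambda>x. x + - g) ` K)) \<le> open_content W"
      by (intro content_le_open_content compact_right_translation K)
    then show "ennreal (l K) \<le> open_content W" unfolding l_transl[OF K(1)] .
  qed
  have outer_transl: "outer_content ((\<lambda>x. x + g) ` A) \<le> outer_content A" for A g
  proof (rule outer_content_geI)
    fix W assume W: "open W" "A \<subseteq> W"
    have "outer_content ((\<lambda>x. x + g) ` A) \<le> open_content ((\<lambda>x. x + g) ` W)"
      using W by (intro outer_content_le_open_content open_right_translation) auto
    then show "outer_content ((\<lambda>x. x + g) ` A) \<le> open_content W"
      using open_transl by (rule order_trans)
  qed
  have "distr borel_extension borel (\<lambda>x. x + g) = borel_extension" for g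
  proof (rule measure_eqI)
    fix A assume "A \<in> sets (distr borel_extension borel (\<lambda>x. x + g))"
    then have A: "A \<in> sets borel" by simp
    have cont: "(\<lambda>x. x + g) \<in> borel \<rightarrow>\<^sub>M borel"
      by (intro borel_measurable_continuous_onI continuous_intros)
    then have meas: "(\<lambda>x. x + g) \<in> borel_extension \<rightarrow>\<^sub>M borel"
      by (simp cong: measurable_cong_sets)
    have image: "A = (\<lambda>x. x + g) ` (\<lambda>x. x + - g) ` A"
      by (simp add: image_image add.assoc)
    have "space borel_extension = UNIV"
      using sets_eq_imp_space_eq[OF sets_borel_extension] by simp
    then have "emeasure (distr borel_extension borel (\<lambda>x. x + g)) A = outer_content ((\<lambda>x. x + - g) ` A)"
      using measurable_sets[OF cont A]
      by (simp add: emeasure_distr[OF meas A] emeasure_borel_extension right_translation_vimage)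
    also have "\<dots> = outer_content A"
      using outer_transl[of "- g" A] outer_transl[of g "(\<lambda>x. x + - g) ` A"] image
      by (metis antisym)
    finally show "emeasure (distr borel_extension borel (\<lambda>x. x + g)) A = emeasure borel_extension A"
      using A by (simp add: emeasure_borel_extension)
  qed simp
  moreover have "emeasure borel_extension UNIV \<noteq> 0"
  proof -
    have "1 \<le> outer_content C" using content_le_outer_content[OF UC(2)] by (simp add: l_C)
    also have "\<dots> \<le> emeasure borel_extension UNIV"
      by (simp add: emeasure_borel_extension outer_content_mono)
    finally show ?thesis by auto
  qed
  moreover have "emeasure borel_extension U < \<infinity>"
  proof -
    have "open_content U \<le> ennreal (l C)"
      using UC by (intro open_content_leI ennreal_leI l_mono) auto
    then show ?thesis
      using UC(1) by (simp add: emeasure_borel_extension outer_content_open le_less_trans)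
  qed
  ultimately show ?thesis
    using that[of borel_extension U] UC by simp
qed

text \<open>
  By second countability, countably many translates of a neighbourhood of finite Haar measure cover
  the group. Haar measure is therefore \<open>\<sigma>\<close>-finite, and a strictly positive integrable density turns it
  into a probability measure with the same null sets.
\<close>

theorem exists_right_quasi_invariant_probability:
  assumes "locally_compact_space
    (euclidean :: 'g::{topological_group_add, metric_space, second_countable_topology} topology)"
  obtains \<nu> :: "'g::{topological_group_add, metric_space, second_countable_topology} measure"
  where "prob_space \<nu>" "sets \<nu> = sets borel"
    "\<And>P g. (AE x in \<nu>. P x) \<Longrightarrow> (AE x in \<nu>. P (x + g))"
proof -
  obtain \<mu> :: "'g measure" and U where \<mu>: "sets \<mu> = sets borel" "\<And>g. distr \<mu> borel (\<lambda>x. x + g) = \<mu>"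
    "emeasure \<mu> UNIV \<noteq> 0" and U: "open U" "0 \<in> U" "emeasure \<mu> U < \<infinity>"
    using exists_right_haar_measure[OF assms] by blast
  have space: "space \<mu> = UNIV" using sets_eq_imp_space_eq[OF \<mu>(1)] by simp
  have meas: "(\<lambda>x. x + g) \<in> \<mu> \<rightarrow>\<^sub>M borel" for g
    unfolding measurable_cong_sets[OF \<mu>(1) refl]
    by (intro borel_measurable_continuous_onI continuous_intros)
  have translate: "emeasure \<mu> ((\<lambda>x. x + g) ` U) = emeasure \<mu> U" for g
  proof -
    have "(\<lambda>x. x + - g) -` U = (\<lambda>x. x + g) ` U"
      by (simp only: right_translation_vimage minus_minus)
    then show ?thesis
      using emeasure_distr[OF meas[of "- g"], of U] \<mu>(2)[of "- g"] U(1) by (simp add: space)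
  qed
  obtain \<F> where \<F>: "\<F> \<subseteq> range (\<lambda>g. (\<lambda>x. x + g) ` U)" "countable \<F>"
    "\<Union>\<F> = (\<Union>g. (\<lambda>x. x + g) ` U)"
    using Lindelof[of "range (\<lambda>g. (\<lambda>x. x + g) ` U)"] open_right_translation[OF U(1)] by auto
  have "x \<in> (\<Union>g. (\<lambda>x. x + g) ` U)" for x
    using U(2) by (auto simp: image_iff intro!: bexI[of _ 0] exI[of _ x])
  then have "(\<Union>g. (\<lambda>x. x + g) ` U) = UNIV" by blast
  interpret sigma_finite_measure \<mu>
  proof
    show "\<exists>A. countable A \<and> A \<subseteq> sets \<mu> \<and> \<Union> A = space \<mu> \<and> (\<forall>a\<in>A. emeasure \<mu> a \<noteq> \<infinity>)"
    proof (intro exI[of _ \<F>] conjI)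
      show "\<F> \<subseteq> sets \<mu>"
        using \<F>(1) open_right_translation[OF U(1)] unfolding \<mu>(1) by (auto intro: borel_open)
      show "\<Union>\<F> = space \<mu>"
        using \<F>(3) \<open>(\<Union>g. (\<lambda>x. x + g) ` U) = UNIV\<close> space by simp
      show "\<forall>a\<in>\<F>. emeasure \<mu> a \<noteq> \<infinity>"
      proof
        fix a assume "a \<in> \<F>"
        then obtain g where "a = (\<lambda>x. x + g) ` U" using \<F>(1) by blast
        then show "emeasure \<mu> a \<noteq> \<infinity>" using translate[of g] U(3) by simp
      qed
    qed (rule \<F>(2))
  qed
  obtain f :: "'g \<Rightarrow> real" where f_meas: "f \<in> borel_measurable \<mu>"
    and f_pos: "\<And>x. f x > 0" and f_int: "integrable \<mu> f"
    by (rule obtain_positive_integrable_function) (rule that)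
  note f = f_meas f_pos f_int
  define I where "I = (\<integral>x. f x \<partial>\<mu>)"
  have "I \<ge> 0" unfolding I_def using f(2) by (intro integral_nonneg_AE) (auto intro: less_imp_le)
  moreover have "I \<noteq> 0"
  proof
    assume "I = 0"
    then have "AE x in \<mu>. f x = 0"
      unfolding I_def using f by (subst (asm) integral_nonneg_eq_0_iff_AE) (auto intro: less_imp_le)
    then have "AE x in \<mu>. False" using f(2) by (auto elim!: eventually_mono simp: less_imp_neq[symmetric])
    then have "UNIV \<in> null_sets \<mu>" using AE_iff_null_sets[of UNIV \<mu>] by (simp add: \<mu>(1))
    then show False using \<mu>(3) by auto
  qed
  ultimately have "I > 0" by simp
  let ?\<nu> = "density \<mu> (\<lambda>x. ennreal (f x / I))"
  have AE: "(AE x in ?\<nu>. P x) \<longleftrightarrow> (AE x in \<mu>. P x)" for P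
    using f \<open>I > 0\<close> by (simp add: AE_density)
  have "prob_space ?\<nu>"
  proof
    have "emeasure ?\<nu> (space ?\<nu>) = (\<integral>\<^sup>+x. ennreal (f x / I) \<partial>\<mu>)"
      using f by (simp add: emeasure_density cong: nn_integral_cong)
    also have "\<dots> = ennreal (\<integral>x. f x / I \<partial>\<mu>)"
      using f \<open>I > 0\<close> by (intro nn_integral_eq_integral AE_I2) (auto intro: less_imp_le)
    also have "(\<integral>x. f x / I \<partial>\<mu>) = 1" using \<open>I > 0\<close> by (simp add: I_def)
    finally show "emeasure ?\<nu> (space ?\<nu>) = 1" by simp
  qed
  moreover have "AE x in ?\<nu>. P (x + g)" if "AE x in ?\<nu>. P x" for P g
  proof -
    have "AE x in distr \<mu> borel (\<lambda>x. x + g). P x"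
      using that unfolding AE \<mu>(2) .
    from AE_distrD[OF meas this] show ?thesis unfolding AE .
  qed
  ultimately show ?thesis using that[of ?\<nu>] \<mu>(1) by simp
qed

section \<open>Strictly invariant versions of almost invariant functions\<close>

lemma measurable_actionD:
  assumes "measurable_action \<alpha>"
  shows "\<alpha> 0 x = x" "\<alpha> (g + h) x = \<alpha> g (\<alpha> h x)"
    and "(\<lambda>(g, x). \<alpha> g x) \<in> borel \<Otimes>\<^sub>M borel \<rightarrow>\<^sub>M borel"
    and "\<alpha> g \<in> borel \<rightarrow>\<^sub>M borel"
proof -
  show *: "\<alpha> 0 x = x" "\<alpha> (g + h) x = \<alpha> g (\<alpha> h x)"
    "(\<lambda>(g, x). \<alpha> g x) \<in> borel \<Otimes>\<^sub>M borel \<rightarrow>\<^sub>M borel"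
    using assms unfolding measurable_action_def by auto
  have "(\<lambda>x. (\<lambda>(g, x). \<alpha> g x) (g, x)) \<in> borel \<rightarrow>\<^sub>M borel"
    by (rule measurable_compose[OF _ *(3)]) simp
  then show "\<alpha> g \<in> borel \<rightarrow>\<^sub>M borel" by simp
qed

lemma measurable_action_inverse:
  assumes "measurable_action \<alpha>"
  shows "\<alpha> (- g) (\<alpha> g x) = x" "\<alpha> g (\<alpha> (- g) x) = x"
  using measurable_actionD(1,2)[OF assms, symmetric] by simp_all

lemma borel_measurable_invariant_algebraI:
  fixes f :: "'x::topological_space \<Rightarrow> 'y::topological_space"
  assumes "f \<in> borel_measurable borel" "\<And>g x. f (\<alpha> g x) = f x"
  shows "f \<in> borel_measurable (invariant_algebra \<alpha>)"
proof (rule measurableI)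
  fix S :: "'y set" assume "S \<in> sets borel"
  then have "f -` S \<in> sets borel" using measurable_sets[OF assms(1), of S] by simp
  then show "f -` S \<inter> space (invariant_algebra \<alpha>) \<in> sets (invariant_algebra \<alpha>)"
    by (auto simp: sets_invariant_algebra assms(2))
qed simp

text \<open>
  For the second claim, note that the level set of \<open>f\<close> through \<open>x\<close> is an invariant set.
\<close>

lemma borel_measurable_invariant_algebraD:
  fixes f :: "'x::topological_space \<Rightarrow> 'y::t1_space"
  assumes "f \<in> borel_measurable (invariant_algebra \<alpha>)"
  shows "f \<in> borel_measurable borel" "f (\<alpha> g x) = f x"
proof -
  show "f \<in> borel_measurable borel"
    by (rule measurable_from_subalg[OF _ assms]) (auto simp: subalgebra_def sets_invariant_algebra)
  have "f -` {f x} \<inter> space (invariant_algebra \<alpha>) \<in> sets (invariant_algebra \<alpha>)"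
    by (rule measurable_sets[OF assms]) simp
  then have "\<alpha> g -` f -` {f x} = f -` {f x}" by (simp add: sets_invariant_algebra)
  then have "x \<in> \<alpha> g -` f -` {f x}" by simp
  then show "f (\<alpha> g x) = f x" by simp
qed

text \<open>
  For fixed \<open>g\<close>, almost all \<open>x\<close> satisfy \<open>h (g x) = h x\<close>; by Fubini, for almost all \<open>x\<close> the function
  \<open>g \<mapsto> h (g x)\<close> is almost surely constant with value \<open>h x\<close>. Whether this function is almost surely
  constant, and with which value, depends only on the orbit of \<open>x\<close>: replacing \<open>x\<close> by \<open>k x\<close> translates
  it from the right by \<open>k\<close>, and such translations preserve the null sets on the group.
\<close>

theorem invariant_version_exists:
  fixes \<alpha> :: "'g::{topological_group_add, polish_space} \<Rightarrow> 'x::polish_space \<Rightarrow> 'x"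
    and h :: "'x \<Rightarrow> real"
  assumes lc: "locally_compact_space (euclidean :: 'g topology)"
    and act: "measurable_action \<alpha>"
    and "sigma_finite_measure \<mu>" and sets_\<mu>: "sets \<mu> = sets borel"
    and h: "h \<in> borel_measurable borel"
    and inv: "\<And>g. AE x in \<mu>. h (\<alpha> g x) = h x"
  obtains h' where "h' \<in> borel_measurable (invariant_algebra \<alpha>)" "AE x in \<mu>. h x = h' x"
proof -
  obtain \<nu> :: "'g measure" where "prob_space \<nu>" and sets_\<nu>: "sets \<nu> = sets borel"
    and quasi: "\<And>P g. (AE x in \<nu>. P x) \<Longrightarrow> (AE x in \<nu>. P (x + g))"
    using exists_right_quasi_invariant_probability[OF lc] by blast
  interpret \<nu>: prob_space \<nu> by fact
  interpret \<mu>: sigma_finite_measure \<mu> by fact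
  interpret pair_sigma_finite \<nu> \<mu> by standard
  have [measurable_cong]: "sets \<nu> = sets borel" "sets \<mu> = sets borel" by fact+
  have [measurable]: "(\<lambda>p. \<alpha> (snd p) (fst p)) \<in> borel \<Otimes>\<^sub>M borel \<rightarrow>\<^sub>M borel"
    using measurable_compose[OF measurable_pair_swap' measurable_actionD(3)[OF act]]
    by (simp add: case_prod_beta)
  have [measurable]: "(\<lambda>p. \<alpha> (fst p) (snd p)) \<in> borel \<Otimes>\<^sub>M borel \<rightarrow>\<^sub>M borel"
    using measurable_actionD(3)[OF act] by (simp add: case_prod_beta)
  note h[measurable]
  have [measurable]: "(\<lambda>p. h (\<alpha> (snd p) (fst p))) \<in> borel_measurable (borel \<Otimes>\<^sub>M \<nu>)"
    by measurable
  define m where "m x = (\<integral>g. h (\<alpha> g x) \<partial>\<nu>)" for x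
  have m[measurable]: "m \<in> borel_measurable borel"
    unfolding m_def by (rule \<nu>.borel_measurable_lebesgue_integral) (simp add: case_prod_beta)
  define E where "E x \<longleftrightarrow> (AE g in \<nu>. h (\<alpha> g x) = m x)" for x
  (* Expressing almost sure constancy by an integral makes it a measurable condition on x. *)
  have E_iff: "E x \<longleftrightarrow> (\<integral>\<^sup>+g. ennreal \<bar>h (\<alpha> g x) - m x\<bar> \<partial>\<nu>) = 0" for x
  proof -
    have "(\<lambda>g. h (\<alpha> (snd (x, g)) (fst (x, g)))) \<in> borel_measurable \<nu>" by measurable
    then have "(\<lambda>g. h (\<alpha> g x)) \<in> borel_measurable \<nu>" by simp
    then show ?thesis unfolding E_def by (subst nn_integral_0_iff_AE) auto
  qed
  have "(\<lambda>x. \<integral>\<^sup>+g. ennreal \<bar>h (\<alpha> g x) - m x\<bar> \<partial>\<nu>) \<in> borel_measurable borel"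
    by (rule \<nu>.borel_measurable_nn_integral) (simp add: case_prod_beta)
  then have E_meas[measurable]: "Measurable.pred borel E"
    unfolding E_iff by measurable
  have m_const: "m x = c" if "AE g in \<nu>. h (\<alpha> g x) = c" for x c
  proof -
    have "(\<lambda>g. h (\<alpha> (snd (x, g)) (fst (x, g)))) \<in> borel_measurable \<nu>" by measurable
    then have "m x = (\<integral>g. c \<partial>\<nu>)"
      unfolding m_def using that by (intro integral_cong_AE) auto
    then show ?thesis by (simp add: \<nu>.prob_space)
  qed
  have E_act: "E (\<alpha> g x) \<and> m (\<alpha> g x) = m x" if "E x" for x g
  proof -
    have "AE k in \<nu>. h (\<alpha> (k + g) x) = m x" using quasi that unfolding E_def .
    then have *: "AE k in \<nu>. h (\<alpha> k (\<alpha> g x)) = m x"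
      by (simp add: measurable_actionD(2)[OF act])
    then show ?thesis using m_const[OF *] unfolding E_def by simp
  qed
  have E_act_iff: "E (\<alpha> g x) \<longleftrightarrow> E x" for g x
    by (metis E_act measurable_action_inverse(1)[OF act])
  define h' where "h' x = (if E x then m x else 0)" for x
  show ?thesis
  proof
    show "h' \<in> borel_measurable (invariant_algebra \<alpha>)"
    proof (rule borel_measurable_invariant_algebraI)
      show "h' \<in> borel_measurable borel" unfolding h'_def by measurable
      show "h' (\<alpha> g x) = h' x" for g x unfolding h'_def using E_act[of x g] E_act_iff by auto
    qed
    have "AE g in \<nu>. AE x in \<mu>. h (\<alpha> g x) = h x" using inv by simp
    moreover have "{x \<in> space (\<nu> \<Otimes>\<^sub>M \<mu>). h (\<alpha> (fst x) (snd x)) = h (snd x)} \<in> sets (\<nu> \<Otimes>\<^sub>M \<mu>)"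
      by measurable
    ultimately have "AE x in \<mu>. AE g in \<nu>. h (\<alpha> g x) = h x"
      by (subst (asm) AE_commute) auto
    then show "AE x in \<mu>. h x = h' x"
    proof eventually_elim
      case (elim x)
      then show ?case using m_const[OF elim] unfolding h'_def E_def by simp
    qed
  qed
qed

text \<open>
  Translating a density by \<open>g\<close> gives another density of the same measure, since both measures are
  invariant. Uniqueness of densities makes it almost invariant, so it has an invariant version.
\<close>

theorem invariant_density_exists:
  fixes \<alpha> :: "'g::{topological_group_add, polish_space} \<Rightarrow> 'x::polish_space \<Rightarrow> 'x"
  assumes lc: "locally_compact_space (euclidean :: 'g topology)"
    and act: "measurable_action \<alpha>"
    and \<mu>: "finite_measure \<mu>" "sets \<mu> = sets borel" "invariant_measure \<alpha> \<mu>"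
    and Q: "finite_measure Q" "sets Q = sets borel" "invariant_measure \<alpha> Q"
    and ac: "absolutely_continuous \<mu> Q"
  obtains h where "h \<in> borel_measurable (invariant_algebra \<alpha>)" "\<And>x. 0 \<le> h x"
    "Q = density \<mu> (\<lambda>x. ennreal (h x))"
proof -
  interpret \<mu>: finite_measure \<mu> by fact
  interpret Q: finite_measure Q by fact
  have sets_eq: "sets Q = sets \<mu>" using \<mu>(2) Q(2) by simp
  obtain D where D: "D \<in> borel_measurable \<mu>" "AE x in \<mu>. RN_deriv \<mu> Q x = ennreal (D x)"
    "\<And>x. 0 \<le> D x"
    using \<mu>.real_RN_deriv[OF Q(1) ac sets_eq] by metis
  have D_borel[measurable]: "D \<in> borel_measurable borel"
    using D(1) by (simp add: measurable_cong_sets[OF \<mu>(2) refl])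
  have [measurable_cong]: "sets \<mu> = sets borel" by fact
  have act_meas[measurable]: "\<alpha> g \<in> borel \<rightarrow>\<^sub>M borel" for g by (rule measurable_actionD(4)[OF act])
  have Q_D: "Q = density \<mu> (\<lambda>x. ennreal (D x))"
    using \<mu>.density_RN_deriv[OF ac sets_eq] D(1,2)
    by (metis density_cong borel_measurable_RN_deriv measurable_compose_rev measurable_ennreal)
  have "AE x in \<mu>. D (\<alpha> g x) = D x" for g
  proof -
    let ?R = "density \<mu> (\<lambda>x. ennreal (D (\<alpha> g x)))"
    have "distr ?R borel (\<alpha> g) = density (distr \<mu> borel (\<alpha> g)) (\<lambda>x. ennreal (D x))"
      by (rule density_distr[symmetric]) measurable
    also have "\<dots> = Q" using \<mu>(3) Q_D by (simp add: invariant_measure_def)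
    finally have "distr Q borel (\<alpha> (- g)) = distr (distr ?R borel (\<alpha> g)) borel (\<alpha> (- g))"
      by simp
    also have "\<dots> = distr ?R borel (\<lambda>x. x)"
      by (subst distr_distr) (auto simp: comp_def measurable_action_inverse[OF act])
    also have "\<dots> = ?R" by (rule distr_id2) (simp add: \<mu>(2))
    finally have "Q = ?R" using Q(3) by (simp add: invariant_measure_def)
    then have "AE x in \<mu>. ennreal (D (\<alpha> g x)) = ennreal (D x)"
      using Q_D by (intro \<mu>.density_unique) auto
    then show ?thesis using D(3) by simp
  qed
  then obtain h where h: "h \<in> borel_measurable (invariant_algebra \<alpha>)" "AE x in \<mu>. D x = h x"
    using invariant_version_exists[OF lc act \<mu>.sigma_finite_measure_axioms \<mu>(2) D_borel] by blast
  have "Q = density \<mu> (\<lambda>x. ennreal \<bar>h x\<bar>)"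
    unfolding Q_D using h(2) D(3) borel_measurable_invariant_algebraD(1)[OF h(1)]
    by (intro density_cong) (auto elim!: eventually_mono, metis abs_of_nonneg)
  then show ?thesis
    using h(1) by (intro that[of "\<lambda>x. \<bar>h x\<bar>"]) auto
qed

text \<open>
  The density of \<open>Q\<close> can be chosen measurable with respect to the invariant \<open>\<sigma>\<close>-algebra, and is then
  determined by the restriction of \<open>Q\<close> to that \<open>\<sigma>\<close>-algebra.
\<close>

corollary invariant_measure_eqI:
  fixes \<alpha> :: "'g::{topological_group_add, polish_space} \<Rightarrow> 'x::polish_space \<Rightarrow> 'x"
  assumes lc: "locally_compact_space (euclidean :: 'g topology)"
    and act: "measurable_action \<alpha>"
    and \<mu>: "finite_measure \<mu>" "sets \<mu> = sets borel" "invariant_measure \<alpha> \<mu>"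
    and Q: "finite_measure Q" "sets Q = sets borel" "invariant_measure \<alpha> Q"
    and ac: "absolutely_continuous \<mu> Q"
    and eq: "\<And>A. A \<in> sets (invariant_algebra \<alpha>) \<Longrightarrow> emeasure Q A = emeasure \<mu> A"
  shows "Q = \<mu>"
proof -
  obtain h where h: "h \<in> borel_measurable (invariant_algebra \<alpha>)" "\<And>x. 0 \<le> h x"
    "Q = density \<mu> (\<lambda>x. ennreal (h x))"
    using invariant_density_exists[OF lc act \<mu> Q ac] by blast
  have sub: "subalgebra \<mu> (invariant_algebra \<alpha>)"
    using sets_eq_imp_space_eq[OF \<mu>(2)]
    by (auto simp: subalgebra_def \<mu>(2) sets_invariant_algebra)
  let ?\<mu> = "restr_to_subalg \<mu> (invariant_algebra \<alpha>)"
  have hm: "h \<in> borel_measurable ?\<mu>" "h \<in> borel_measurable \<mu>"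
    using h(1) measurable_from_subalg[OF sub h(1)]
    by (simp_all add: measurable_cong_sets[OF sets_restr_to_subalg[OF sub] refl])
  interpret \<mu>': finite_measure ?\<mu>
    using sub \<mu>(1) by (rule finite_measure_restr_to_subalg)
  have "density ?\<mu> (\<lambda>x. ennreal (h x)) = density ?\<mu> (\<lambda>x. 1)"
  proof (rule measure_eqI)
    fix A assume "A \<in> sets (density ?\<mu> (\<lambda>x. ennreal (h x)))"
    then have A: "A \<in> sets (invariant_algebra \<alpha>)" by (simp add: sets_restr_to_subalg[OF sub])
    then have A': "A \<in> sets ?\<mu>" "A \<in> sets \<mu>"
      using sub by (auto simp: sets_restr_to_subalg[OF sub] subalgebra_def)
    have [measurable]: "h \<in> borel_measurable (invariant_algebra \<alpha>)" "A \<in> sets (invariant_algebra \<alpha>)"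
      by fact+
    have "(\<lambda>x. ennreal (h x) * indicator A x) \<in> borel_measurable (invariant_algebra \<alpha>)"
      by measurable
    then have "emeasure (density ?\<mu> (\<lambda>x. ennreal (h x))) A = (\<integral>\<^sup>+x. ennreal (h x) * indicator A x \<partial>\<mu>)"
      using hm A' h(1) A by (simp add: emeasure_density nn_integral_subalgebra2[OF sub])
    also have "\<dots> = emeasure Q A" using hm A' unfolding h(3) by (simp add: emeasure_density)
    also have "\<dots> = emeasure (density ?\<mu> (\<lambda>x. 1)) A"
      using A A' eq[OF A] by (simp add: emeasure_restr_to_subalg[OF sub] density_1)
    finally show "emeasure (density ?\<mu> (\<lambda>x. ennreal (h x))) A = emeasure (density ?\<mu> (\<lambda>x. 1)) A" .
  qed simp
  then have "AE x in ?\<mu>. ennreal (h x) = 1" using hm by (intro \<mu>'.density_unique) auto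
  then have "AE x in \<mu>. ennreal (h x) = 1" by (rule AE_restr_to_subalg[OF sub])
  then have "Q = density \<mu> (\<lambda>x. 1)" unfolding h(3) using hm by (intro density_cong) auto
  then show ?thesis by (simp add: density_1)
qed

section \<open>Separation in the space of integrable functions\<close>

definition function_space :: "('x \<Rightarrow> real) set \<Rightarrow> bool" where
  "function_space V \<longleftrightarrow> (\<lambda>_. 0) \<in> V \<and> (\<forall>f\<in>V. \<forall>g\<in>V. (\<lambda>x. f x + g x) \<in> V) \<and>
     (\<forall>f\<in>V. \<forall>a. (\<lambda>x. a * f x) \<in> V)"

lemma function_spaceD:
  assumes "function_space V"
  shows "(\<lambda>_. 0) \<in> V" "f \<in> V \<Longrightarrow> g \<in> V \<Longrightarrow> (\<lambda>x. f x + g x) \<in> V" "f \<in> V \<Longrightarrow> (\<lambda>x. a * f x) \<in> V"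
  using assms[unfolded function_space_def, THEN conjunct1]
    assms[unfolded function_space_def, THEN conjunct2, THEN conjunct1, rule_format, of f g]
    assms[unfolded function_space_def, THEN conjunct2, THEN conjunct2, rule_format, of f a]
  by blast+

definition sublinear_on :: "('x \<Rightarrow> real) set \<Rightarrow> (('x \<Rightarrow> real) \<Rightarrow> real) \<Rightarrow> bool" where
  "sublinear_on V q \<longleftrightarrow> (\<forall>f\<in>V. \<forall>g\<in>V. q (\<lambda>x. f x + g x) \<le> q f + q g) \<and>
     (\<forall>f\<in>V. \<forall>a\<ge>0. q (\<lambda>x. a * f x) = a * q f)"

lemma sublinear_onD:
  assumes "sublinear_on V q"
  shows "f \<in> V \<Longrightarrow> g \<in> V \<Longrightarrow> q (\<lambda>x. f x + g x) \<le> q f + q g"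
    and "f \<in> V \<Longrightarrow> a \<ge> 0 \<Longrightarrow> q (\<lambda>x. a * f x) = a * q f"
  using assms[unfolded sublinear_on_def, THEN conjunct1, rule_format, of f g]
    assms[unfolded sublinear_on_def, THEN conjunct2, rule_format, of f a]
  by blast+

lemma sublinear_on_zero:
  assumes "function_space V" "sublinear_on V q"
  shows "q (\<lambda>_. 0) = 0"
  using sublinear_onD(2)[OF assms(2) function_spaceD(1)[OF assms(1)], of 0] by simp

lemma sublinear_on_minus:
  assumes V: "function_space V" and q: "sublinear_on V q" and f: "f \<in> V"
  shows "- q (\<lambda>x. - f x) \<le> q f"
proof -
  have "(\<lambda>x. - f x) \<in> V" using function_spaceD(3)[OF V f, of "- 1"] by simp
  from sublinear_onD(1)[OF q f this] show ?thesis by (simp add: sublinear_on_zero[OF V q])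
qed

text \<open>
  The tilt of a sublinear functional \<open>q\<close> in the direction \<open>y\<close> is again sublinear, lies below \<open>q\<close>, and is
  at most \<open>- q y\<close> at \<open>- y\<close>. Tilting serves twice: a linear functional below the tilt agrees with \<open>q\<close> at
  \<open>y\<close>, and a minimal sublinear functional equals all its tilts, which forces it to be linear.
\<close>

definition tilt :: "('x \<Rightarrow> real) \<Rightarrow> (('x \<Rightarrow> real) \<Rightarrow> real) \<Rightarrow> ('x \<Rightarrow> real) \<Rightarrow> real" where
  "tilt y q f = (INF t\<in>{0..}. q (\<lambda>x. f x + t * y x) - t * q y)"

text \<open>
  The infimum that defines the tilt is over a set that is bounded below.
\<close>

lemma tilt_bound:
  assumes V: "function_space V" and q: "sublinear_on V q" and "y \<in> V" "f \<in> V" "t \<ge> 0"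
  shows "- q (\<lambda>x. - f x) \<le> q (\<lambda>x. f x + t * y x) - t * q y"
proof -
  have ty: "(\<lambda>x. t * y x) \<in> V" and mf: "(\<lambda>x. - f x) \<in> V"
    using function_spaceD(3)[OF V, of _ "- 1"] function_spaceD(3)[OF V] assms by auto
  have "t * q y = q (\<lambda>x. (f x + t * y x) + - f x)"
    using sublinear_onD(2)[OF q \<open>y \<in> V\<close> \<open>t \<ge> 0\<close>] by simp
  also have "\<dots> \<le> q (\<lambda>x. f x + t * y x) + q (\<lambda>x. - f x)"
    by (intro sublinear_onD(1)[OF q] function_spaceD(2)[OF V] ty mf assms)
  finally show ?thesis by simp
qed

lemma tilt_le:
  assumes "function_space V" "sublinear_on V q" "y \<in> V" "f \<in> V" "t \<ge> 0"
  shows "tilt y q f \<le> q (\<lambda>x. f x + t * y x) - t * q y"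
  unfolding tilt_def
proof (rule cINF_lower)
  show "bdd_below ((\<lambda>t. q (\<lambda>x. f x + t * y x) - t * q y) ` {0..})"
    by (rule bdd_belowI2[of _ "- q (\<lambda>x. - f x)"]) (use tilt_bound[OF assms(1-4)] in simp)
qed (use assms(5) in simp)

lemma tilt_ge:
  assumes "\<And>t. t \<ge> 0 \<Longrightarrow> c \<le> q (\<lambda>x. f x + t * y x) - t * q y"
  shows "c \<le> tilt y q f"
  unfolding tilt_def using assms by (intro cINF_greatest) auto

lemma sublinear_tilt:
  assumes V: "function_space V" and q: "sublinear_on V q" and y: "y \<in> V"
  shows "sublinear_on V (tilt y q)"
  unfolding sublinear_on_def
proof (intro conjI ballI allI impI)
  fix f g assume f: "f \<in> V" and g: "g \<in> V"
  have fg: "(\<lambda>x. f x + g x) \<in> V" by (rule function_spaceD(2)[OF V f g])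
  have "tilt y q (\<lambda>x. f x + g x) - (q (\<lambda>x. g x + t * y x) - t * q y) \<le> tilt y q f" if t: "t \<ge> 0" for t
  proof (rule tilt_ge)
    fix s :: real assume s: "s \<ge> 0"
    have "tilt y q (\<lambda>x. f x + g x) \<le> q (\<lambda>x. (f x + g x) + (s + t) * y x) - (s + t) * q y"
      using s t by (intro tilt_le[OF V q y fg]) auto
    also have "(\<lambda>x. (f x + g x) + (s + t) * y x) = (\<lambda>x. (f x + s * y x) + (g x + t * y x))"
      by (simp add: algebra_simps)
    also have "q \<dots> \<le> q (\<lambda>x. f x + s * y x) + q (\<lambda>x. g x + t * y x)"
      by (intro sublinear_onD(1)[OF q] function_spaceD(2,3)[OF V] f g y)
    finally show "tilt y q (\<lambda>x. f x + g x) - (q (\<lambda>x. g x + t * y x) - t * q y)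
        \<le> q (\<lambda>x. f x + s * y x) - s * q y"
      by (simp add: algebra_simps)
  qed
  then have "tilt y q (\<lambda>x. f x + g x) - tilt y q f \<le> tilt y q g"
    by (intro tilt_ge) (simp add: algebra_simps)
  then show "tilt y q (\<lambda>x. f x + g x) \<le> tilt y q f + tilt y q g" by simp
next
  fix f :: "'a \<Rightarrow> real" and a :: real assume f: "f \<in> V" and a: "a \<ge> 0"
  have af: "(\<lambda>x. a * f x) \<in> V" by (rule function_spaceD(3)[OF V f])
  show "tilt y q (\<lambda>x. a * f x) = a * tilt y q f"
  proof (cases "a = 0")
    case True
    have "tilt y q (\<lambda>x. 0) = (INF t\<in>{0::real..}. 0)"
      unfolding tilt_def by (intro INF_cong refl) (use sublinear_onD(2)[OF q y] in auto)
    then show ?thesis using True by simp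
  next
    case False
    then have "a > 0" using a by simp
    have scale: "q (\<lambda>x. a * f x + (a * t) * y x) - (a * t) * q y
        = a * (q (\<lambda>x. f x + t * y x) - t * q y)" for t
    proof -
      have "q (\<lambda>x. a * (f x + t * y x)) = a * q (\<lambda>x. f x + t * y x)"
        by (intro sublinear_onD(2)[OF q] function_spaceD(2,3)[OF V] f y a)
      then show ?thesis by (simp add: algebra_simps)
    qed
    show ?thesis
    proof (rule antisym)
      have "tilt y q (\<lambda>x. a * f x) / a \<le> tilt y q f"
      proof (rule tilt_ge)
        fix t :: real assume "t \<ge> 0"
        then have "tilt y q (\<lambda>x. a * f x) \<le> q (\<lambda>x. a * f x + (a * t) * y x) - (a * t) * q y"
          using a by (intro tilt_le[OF V q y af]) auto
        then show "tilt y q (\<lambda>x. a * f x) / a \<le> q (\<lambda>x. f x + t * y x) - t * q y"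
          using \<open>a > 0\<close> unfolding scale by (simp add: field_simps)
      qed
      then show "tilt y q (\<lambda>x. a * f x) \<le> a * tilt y q f"
        using \<open>a > 0\<close> by (simp add: field_simps)
    next
      show "a * tilt y q f \<le> tilt y q (\<lambda>x. a * f x)"
      proof (rule tilt_ge)
        fix t :: real assume "t \<ge> 0"
        then have "tilt y q f \<le> q (\<lambda>x. f x + (t / a) * y x) - (t / a) * q y"
          using a by (intro tilt_le[OF V q y f]) auto
        then have "a * tilt y q f \<le> a * (q (\<lambda>x. f x + (t / a) * y x) - (t / a) * q y)"
          using a by (rule mult_left_mono)
        then show "a * tilt y q f \<le> q (\<lambda>x. a * f x + t * y x) - t * q y"
          using scale[of "t / a"] \<open>a > 0\<close> by simp
      qed
    qed
  qed
qed

lemma tilt_le_self: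
  assumes "function_space V" "sublinear_on V q" "y \<in> V" "f \<in> V"
  shows "tilt y q f \<le> q f"
  using tilt_le[OF assms, of 0] by simp

lemma tilt_minus_le:
  assumes V: "function_space V" and q: "sublinear_on V q" and y: "y \<in> V"
  shows "tilt y q (\<lambda>x. - y x) \<le> - q y"
  using tilt_le[OF V q y, of "\<lambda>x. - y x" 1] function_spaceD(3)[OF V y, of "- 1"]
  by (simp add: sublinear_on_zero[OF V q])

text \<open>
  In a chain, two functionals used at \<open>f\<close> and at \<open>g\<close> can be replaced by the smaller of them; this gives
  subadditivity of the infimum, which fails for general families.
\<close>

lemma chain_Inf_sublinear:
  assumes V: "function_space V" and C: "C \<noteq> {}" "\<And>p. p \<in> C \<Longrightarrow> sublinear_on V p"
    and chain: "\<And>p r. p \<in> C \<Longrightarrow> r \<in> C \<Longrightarrow> (\<forall>f\<in>V. p f \<le> r f) \<or> (\<forall>f\<in>V. r f \<le> p f)"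
    and bdd: "\<And>f. f \<in> V \<Longrightarrow> bdd_below ((\<lambda>p. p f) ` C)"
  shows "sublinear_on V (\<lambda>f. INF p\<in>C. p f)"
  unfolding sublinear_on_def
proof (intro conjI ballI allI impI)
  fix f g assume f: "f \<in> V" and g: "g \<in> V"
  have fg: "(\<lambda>x. f x + g x) \<in> V" by (rule function_spaceD(2)[OF V f g])
  have *: "(INF p\<in>C. p (\<lambda>x. f x + g x)) \<le> p f + r g" if "p \<in> C" "r \<in> C" for p r
  proof -
    obtain s where s: "s \<in> C" "s f \<le> p f" "s g \<le> r g" using chain[of p r] \<open>p \<in> C\<close> \<open>r \<in> C\<close> f g by blast
    have "(INF p\<in>C. p (\<lambda>x. f x + g x)) \<le> s (\<lambda>x. f x + g x)"
      using s(1) by (intro cINF_lower bdd fg)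
    also have "\<dots> \<le> s f + s g" by (rule sublinear_onD(1)[OF C(2)[OF s(1)] f g])
    finally show ?thesis using s by simp
  qed
  have "(INF p\<in>C. p (\<lambda>x. f x + g x)) - r g \<le> (INF p\<in>C. p f)" if "r \<in> C" for r
    using *[OF _ that] by (intro cINF_greatest C(1)) (simp add: algebra_simps)
  then have "(INF p\<in>C. p (\<lambda>x. f x + g x)) - (INF p\<in>C. p f) \<le> (INF r\<in>C. r g)"
    by (intro cINF_greatest C(1)) (simp add: algebra_simps)
  then show "(INF p\<in>C. p (\<lambda>x. f x + g x)) \<le> (INF p\<in>C. p f) + (INF p\<in>C. p g)" by simp
next
  fix f :: "'a \<Rightarrow> real" and a :: real assume f: "f \<in> V" and a: "a \<ge> 0"
  have "(INF p\<in>C. p (\<lambda>x. a * f x)) = (INF p\<in>C. a * p f)"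
    by (intro INF_cong refl sublinear_onD(2)[OF C(2) f a])
  also have "\<dots> = a * (INF p\<in>C. p f)"
  proof (cases "a = 0")
    case False
    then have "a > 0" using a by simp
    show ?thesis
    proof (rule antisym)
      have "(INF p\<in>C. a * p f) / a \<le> (INF p\<in>C. p f)"
      proof (rule cINF_greatest[OF C(1)])
        fix p assume "p \<in> C"
        have "bdd_below ((\<lambda>p. a * p f) ` C)"
          using bdd[OF f] mult_left_mono[OF _ a] unfolding bdd_below_def by (auto 4 4)
        then have "(INF p\<in>C. a * p f) \<le> a * p f" using \<open>p \<in> C\<close> by (intro cINF_lower)
        then show "(INF p\<in>C. a * p f) / a \<le> p f" using \<open>a > 0\<close> by (simp add: field_simps)
      qed
      then show "(INF p\<in>C. a * p f) \<le> a * (INF p\<in>C. p f)" using \<open>a > 0\<close> by (simp add: field_simps)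
      show "a * (INF p\<in>C. p f) \<le> (INF p\<in>C. a * p f)"
        by (intro cINF_greatest C(1) mult_left_mono cINF_lower bdd f a)
    qed
  qed (simp add: C(1))
  finally show "(INF p\<in>C. p (\<lambda>x. a * f x)) = a * (INF p\<in>C. p f)" .
qed

text \<open>
  Zorn's lemma for the reversed pointwise order on \<open>V\<close>. The functionals are normalised to vanish outside
  \<open>V\<close>, as that order would not be antisymmetric otherwise.
\<close>

lemma minimal_sublinear_exists:
  assumes V: "function_space V" and q: "sublinear_on V q"
  obtains m where "sublinear_on V m" "\<And>f. f \<in> V \<Longrightarrow> m f \<le> q f"
    "\<And>p f. sublinear_on V p \<Longrightarrow> (\<And>g. g \<in> V \<Longrightarrow> p g \<le> m g) \<Longrightarrow> f \<in> V \<Longrightarrow> p f = m f"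
proof -
  define A where "A = {p. sublinear_on V p \<and> (\<forall>f\<in>V. p f \<le> q f) \<and> (\<forall>f. f \<notin> V \<longrightarrow> p f = 0)}"
  define P where "P p r \<longleftrightarrow> (\<forall>f\<in>V. r f \<le> p f)" for p r :: "('a \<Rightarrow> real) \<Rightarrow> real"
  have restrict: "(\<lambda>f. if f \<in> V then p f else 0) \<in> A" if "sublinear_on V p" "\<forall>f\<in>V. p f \<le> q f" for p
    using that function_spaceD[OF V] unfolding A_def sublinear_on_def by auto
  have "\<exists>m\<in>A. \<forall>a\<in>A. P m a \<longrightarrow> a = m"
  proof (rule predicate_Zorn)
    show "partial_order_on A (relation_of P A)"
    proof (rule partial_order_on_relation_ofI)
      fix p r assume "p \<in> A" "r \<in> A" "P p r" "P r p"
      show "p = r"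
      proof
        fix f show "p f = r f"
          using \<open>p \<in> A\<close> \<open>r \<in> A\<close> \<open>P p r\<close> \<open>P r p\<close> unfolding A_def P_def
          by (cases "f \<in> V") (auto intro: antisym)
      qed
    qed (auto simp: P_def intro: order_trans)
    fix C assume C: "C \<in> Chains (relation_of P A)"
    then have CA: "C \<subseteq> A" and chain: "\<And>p r. p \<in> C \<Longrightarrow> r \<in> C \<Longrightarrow> P p r \<or> P r p"
      unfolding Chains_def relation_of_def by auto
    show "\<exists>u\<in>A. \<forall>a\<in>C. P a u"
    proof (cases "C = {}")
      case True
      then show ?thesis using restrict[OF q] by auto
    next
      case False
      have bdd: "bdd_below ((\<lambda>p. p f) ` C)" if f: "f \<in> V" for f
      proof (rule bdd_belowI2)
        fix p assume "p \<in> C"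
        then have p: "sublinear_on V p" "\<forall>f\<in>V. p f \<le> q f" using CA unfolding A_def by auto
        have "(\<lambda>x. - f x) \<in> V" using function_spaceD(3)[OF V f, of "- 1"] by simp
        then show "- q (\<lambda>x. - f x) \<le> p f"
          using sublinear_on_minus[OF V p(1) f] p(2) by force
      qed
      have "sublinear_on V (\<lambda>f. INF p\<in>C. p f)"
        using CA chain by (intro chain_Inf_sublinear[OF V False] bdd) (auto simp: A_def P_def)
      moreover have "\<forall>f\<in>V. (INF p\<in>C. p f) \<le> q f"
      proof
        fix f assume f: "f \<in> V"
        obtain p where "p \<in> C" using False by blast
        then have "(INF p\<in>C. p f) \<le> p f" by (intro cINF_lower bdd f)
        also have "\<dots> \<le> q f" using \<open>p \<in> C\<close> CA f unfolding A_def by auto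
        finally show "(INF p\<in>C. p f) \<le> q f" .
      qed
      ultimately have "(\<lambda>f. if f \<in> V then INF p\<in>C. p f else 0) \<in> A" by (rule restrict)
      moreover have "P a (\<lambda>f. if f \<in> V then INF p\<in>C. p f else 0)" if "a \<in> C" for a
        using that unfolding P_def by (auto intro!: cINF_lower bdd)
      ultimately show ?thesis by blast
    qed
  qed
  then obtain m where m: "m \<in> A" "\<And>p. p \<in> A \<Longrightarrow> P m p \<Longrightarrow> p = m" by blast
  show ?thesis
  proof (rule that[of m])
    show "m f \<le> q f" if "f \<in> V" for f using m(1) that unfolding A_def by blast
    show "sublinear_on V m" using m(1) unfolding A_def by blast
    fix p f assume p: "sublinear_on V p" "\<And>g. g \<in> V \<Longrightarrow> p g \<le> m g" and f: "f \<in> V"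
    have "\<forall>f\<in>V. p f \<le> q f" using p(2) m(1) unfolding A_def by force
    then have "(\<lambda>f. if f \<in> V then p f else 0) = m"
      by (intro m(2) restrict p(1)) (auto simp: P_def p(2))
    then show "p f = m f" using f by meson
  qed
qed

text \<open>
  A minimal sublinear functional \<open>l\<close> below the tilt of \<open>q\<close> in the direction \<open>y\<close> equals its own tilts, so
  \<open>l (- f) = - l f\<close> for all \<open>f\<close>. A sublinear functional with this property is linear.
\<close>

theorem Hahn_Banach_function_space:
  assumes V: "function_space V" and q: "sublinear_on V q" and y: "y \<in> V"
  obtains l where "\<And>f g. f \<in> V \<Longrightarrow> g \<in> V \<Longrightarrow> l (\<lambda>x. f x + g x) = l f + l g"
    "\<And>f a. f \<in> V \<Longrightarrow> l (\<lambda>x. a * f x) = a * l f"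
    "\<And>f. f \<in> V \<Longrightarrow> l f \<le> q f" "l y = q y"
proof -
  obtain l where l: "sublinear_on V l" "\<And>f. f \<in> V \<Longrightarrow> l f \<le> tilt y q f"
    and minimal: "\<And>p f. sublinear_on V p \<Longrightarrow> (\<And>g. g \<in> V \<Longrightarrow> p g \<le> l g) \<Longrightarrow> f \<in> V \<Longrightarrow> p f = l f"
    using minimal_sublinear_exists[OF V sublinear_tilt[OF V q y]] by blast
  have neg_in: "(\<lambda>x. - f x) \<in> V" if "f \<in> V" for f
    using function_spaceD(3)[OF V that, of "- 1"] by simp
  have le_q: "l f \<le> q f" if "f \<in> V" for f
    using l(2)[OF that] tilt_le_self[OF V q y that] by simp
  have neg: "l (\<lambda>x. - f x) = - l f" if f: "f \<in> V" for f
  proof (rule antisym)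
    have "tilt f l (\<lambda>x. - f x) = l (\<lambda>x. - f x)"
      using f by (intro minimal sublinear_tilt[OF V l(1)] tilt_le_self[OF V l(1)] neg_in)
    then show "l (\<lambda>x. - f x) \<le> - l f" using tilt_minus_le[OF V l(1) f] by simp
    show "- l f \<le> l (\<lambda>x. - f x)" using sublinear_on_minus[OF V l(1) f] by simp
  qed
  show ?thesis
  proof (rule that[of l])
    fix f g assume f: "f \<in> V" and g: "g \<in> V"
    have "l (\<lambda>x. (f x + g x) + - g x) \<le> l (\<lambda>x. f x + g x) + l (\<lambda>x. - g x)"
      by (intro sublinear_onD(1)[OF l(1)] function_spaceD(2)[OF V] neg_in f g)
    then have "l f + l g \<le> l (\<lambda>x. f x + g x)" using neg[OF g] by simp
    with sublinear_onD(1)[OF l(1) f g] show "l (\<lambda>x. f x + g x) = l f + l g" by simp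
  next
    fix f :: "'a \<Rightarrow> real" and a :: real assume f: "f \<in> V"
    show "l (\<lambda>x. a * f x) = a * l f"
    proof (cases "a \<ge> 0")
      case True
      then show ?thesis by (rule sublinear_onD(2)[OF l(1) f])
    next
      case False
      then have "l (\<lambda>x. (- a) * f x) = (- a) * l f" by (intro sublinear_onD(2)[OF l(1) f]) simp
      then show ?thesis using neg[OF function_spaceD(3)[OF V f, of a]] by simp
    qed
  next
    show "l y = q y"
    proof (rule antisym[OF le_q[OF y]])
      have "l (\<lambda>x. - y x) \<le> - q y" using l(2)[OF neg_in[OF y]] tilt_minus_le[OF V q y] by simp
      then show "q y \<le> l y" using neg[OF y] by simp
    qed
  qed (rule le_q)
qed

text \<open>
  Apply the assumption to the set on which \<open>h\<close> exceeds \<open>c\<close>.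
\<close>

lemma (in finite_measure) AE_le_const_of_set_integrals:
  fixes h :: "'a \<Rightarrow> real"
  assumes h: "integrable M h"
    and le: "\<And>A. A \<in> sets M \<Longrightarrow> (\<integral>x. h x * indicator A x \<partial>M) \<le> c * measure M A"
  shows "AE x in M. h x \<le> c"
proof -
  define A where "A = {x \<in> space M. h x > c}"
  have [measurable]: "h \<in> borel_measurable M" using h by simp
  have A: "A \<in> sets M" unfolding A_def by measurable
  have hA: "integrable M (\<lambda>x. h x * indicator A x)" "integrable M (\<lambda>x. c * indicator A x)"
    using A h by (auto intro!: integrable_real_mult_indicator simp: emeasure_eq_measure)
  have "(\<integral>x. (h x - c) * indicator A x \<partial>M) = (\<integral>x. h x * indicator A x - c * indicator A x \<partial>M)"
    by (simp add: algebra_simps)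
  also have "\<dots> = (\<integral>x. h x * indicator A x \<partial>M) - c * measure M A"
    using A by (subst Bochner_Integration.integral_diff[OF hA]) simp
  finally have le0: "(\<integral>x. (h x - c) * indicator A x \<partial>M) \<le> 0" using le[OF A] by simp
  have nonneg: "AE x in M. 0 \<le> (h x - c) * indicator A x"
    unfolding A_def by (auto split: split_indicator)
  have "integrable M (\<lambda>x. (h x - c) * indicator A x)"
    using A h by (intro integrable_real_mult_indicator) auto
  moreover have "(\<integral>x. (h x - c) * indicator A x \<partial>M) = 0"
    using le0 integral_nonneg_AE[OF nonneg] by simp
  ultimately have "AE x in M. (h x - c) * indicator A x = 0"
    using nonneg by (simp add: integral_nonneg_eq_0_iff_AE)
  then show ?thesis
    using AE_space
  proof eventually_elim
    case (elim x)
    then show ?case by (cases "x \<in> A") (auto simp: A_def)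
  qed
qed

text \<open>
  As \<open>\<bar>l (indicator A)\<bar> \<le> measure M A\<close>, adding the measure of \<open>A\<close> to \<open>l (indicator A)\<close> gives a positive
  set function, and one that is a measure with a density \<open>D \<le> 2\<close>. Then \<open>D - 1\<close> represents \<open>l\<close> on
  indicators, and by continuity on all integrable functions.
\<close>

lemma L1_functional_represented:
  fixes l :: "('x \<Rightarrow> real) \<Rightarrow> real"
  assumes "finite_measure M"
    and add: "\<And>f g. integrable M f \<Longrightarrow> integrable M g \<Longrightarrow> l (\<lambda>x. f x + g x) = l f + l g"
    and scale: "\<And>f a. integrable M f \<Longrightarrow> l (\<lambda>x. a * f x) = a * l f"
    and le: "\<And>f. integrable M f \<Longrightarrow> l f \<le> (\<integral>x. \<bar>f x\<bar> \<partial>M)"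
  obtains \<phi> where "\<phi> \<in> borel_measurable M" "AE x in M. \<bar>\<phi> x\<bar> \<le> 1"
    "\<And>f. integrable M f \<Longrightarrow> l f = (\<integral>x. \<phi> x * f x \<partial>M)"
proof -
  interpret finite_measure M by fact
  have abs_le: "\<bar>l f\<bar> \<le> (\<integral>x. \<bar>f x\<bar> \<partial>M)" if f: "integrable M f" for f
    using le[OF f] le[of "\<lambda>x. - 1 * f x"] scale[OF f, of "- 1"] f by simp
  have diff: "l (\<lambda>x. f x - g x) = l f - l g" if "integrable M f" "integrable M g" for f g
    using add[of f "\<lambda>x. - 1 * g x"] scale[of g "- 1"] that by simp
  have ind: "integrable M (indicator A :: 'x \<Rightarrow> real)" if "A \<in> sets M" for A
    using that by (simp add: emeasure_eq_measure)
  have l_ind: "\<bar>l (indicator A)\<bar> \<le> measure M A" if "A \<in> sets M" for A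
    using abs_le[OF ind[OF that]] that by simp
  (* The measure of A is added to make the set function nonnegative. *)
  define \<nu> where "\<nu> A = ennreal (l (indicator A) + measure M A)" for A
  have \<nu>_le: "\<nu> A \<le> ennreal (2 * measure M A)" if "A \<in> sets M" for A
    unfolding \<nu>_def using l_ind[OF that] by (intro ennreal_leI) auto
  have l_empty: "l (indicator {}) = 0" using l_ind[of "{}"] by simp
  (* Continuity at the empty set is inherited from M, because \<nu> is at most twice M. *)
  have "countably_additive (sets M) \<nu>"
  proof (rule sets.empty_continuous_imp_countably_additive)
    show "positive (sets M) \<nu>" unfolding positive_def \<nu>_def by (simp add: l_empty)
    show "additive (sets M) \<nu>"
      unfolding additive_def
    proof (intro ballI impI)
      fix A B assume A: "A \<in> sets M" and B: "B \<in> sets M" and disj: "A \<inter> B = {}"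
      have "indicator (A \<union> B) = (\<lambda>x. indicator A x + indicator B x :: real)"
        using disj by (auto simp: fun_eq_iff split: split_indicator)
      then have "l (indicator (A \<union> B)) = l (indicator A) + l (indicator B)"
        using add[OF ind[OF A] ind[OF B]] by simp
      moreover have "measure M (A \<union> B) = measure M A + measure M B"
        using A B disj by (rule finite_measure_Union)
      ultimately have "\<nu> (A \<union> B)
          = ennreal ((l (indicator A) + measure M A) + (l (indicator B) + measure M B))"
        unfolding \<nu>_def by (simp add: algebra_simps)
      also have "\<dots> = \<nu> A + \<nu> B"
        unfolding \<nu>_def using l_ind[OF A] l_ind[OF B] by (intro ennreal_plus) auto
      finally show "\<nu> (A \<union> B) = \<nu> A + \<nu> B" .
    qed
    show "\<forall>A\<in>sets M. \<nu> A \<noteq> \<infinity>" unfolding \<nu>_def by simp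
    fix A :: "nat \<Rightarrow> 'x set" assume A: "range A \<subseteq> sets M" "decseq A" "(\<Inter>i. A i) = {}"
    have "(\<lambda>i. ennreal (2 * measure M (A i))) \<longlonglongrightarrow> ennreal (2 * measure M (\<Inter>i. A i))"
      by (intro tendsto_ennrealI tendsto_mult_left finite_Lim_measure_decseq A)
    then have lim: "(\<lambda>i. ennreal (2 * measure M (A i))) \<longlonglongrightarrow> 0" using A(3) by simp
    show "(\<lambda>i. \<nu> (A i)) \<longlonglongrightarrow> 0"
      by (rule tendsto_sandwich[OF _ _ tendsto_const lim])
         (use A(1) in \<open>auto intro!: always_eventually \<nu>_le\<close>)
  qed
  then have emeasure_\<nu>: "emeasure (measure_of (space M) (sets M) \<nu>) A = \<nu> A" if "A \<in> sets M" for A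
    using that by (intro emeasure_measure_of_sigma sets.sigma_algebra_axioms)
      (simp_all add: positive_def \<nu>_def l_empty)
  define N where "N = measure_of (space M) (sets M) \<nu>"
  have sets_N: "sets N = sets M" and space_N: "space N = space M"
    unfolding N_def by simp_all
  have N: "emeasure N A = ennreal (l (indicator A) + measure M A)" if "A \<in> sets M" for A
    using emeasure_\<nu>[OF that] unfolding N_def \<nu>_def .
  have "finite_measure N"
    by (rule finite_measureI) (simp add: space_N N)
  moreover have ac: "absolutely_continuous M N"
    unfolding absolutely_continuous_def
  proof
    fix A assume "A \<in> null_sets M"
    then have A: "A \<in> sets M" "measure M A = 0" by (auto simp: measure_def)
    then have "emeasure N A \<le> ennreal (2 * measure M A)" using \<nu>_le[OF A(1)] N[OF A(1)] \<nu>_def by simp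
    then show "A \<in> null_sets N" using A sets_N by (auto simp: null_sets_def)
  qed
  ultimately obtain D where D[measurable]: "D \<in> borel_measurable M"
    and RN: "AE x in M. RN_deriv M N x = ennreal (D x)" and D_nonneg: "\<And>x. 0 \<le> D x"
    using real_RN_deriv[of N] sets_N by metis
  have N_D: "N = density M (\<lambda>x. ennreal (D x))"
    using density_RN_deriv[OF ac sets_N] density_cong[OF _ _ RN] by simp
  have int_D: "integrable M D"
  proof (rule integrableI_nonneg)
    have "(\<integral>\<^sup>+x. ennreal (D x) \<partial>M) = emeasure N (space M)"
      unfolding N_D by (simp add: emeasure_density cong: nn_integral_cong)
    also have "\<dots> < \<infinity>" by (simp add: N)
    finally show "(\<integral>\<^sup>+x. ennreal (D x) \<partial>M) < \<infinity>" .
  qed (use D_nonneg in auto)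
  have int_ind: "(\<integral>x. D x * indicator A x \<partial>M) = l (indicator A) + measure M A" if A: "A \<in> sets M" for A
  proof -
    have "ennreal (\<integral>x. D x * indicator A x \<partial>M) = (\<integral>\<^sup>+x. ennreal (D x * indicator A x) \<partial>M)"
      using A D_nonneg by (intro nn_integral_eq_integral[symmetric] integrable_real_mult_indicator int_D) auto
    also have "\<dots> = emeasure N A"
      unfolding N_D using A
      by (auto simp: emeasure_density intro!: nn_integral_cong split: split_indicator)
    also have "\<dots> = ennreal (l (indicator A) + measure M A)" by (rule N[OF A])
    finally have eq: "ennreal (\<integral>x. D x * indicator A x \<partial>M) = ennreal (l (indicator A) + measure M A)" .
    have "0 \<le> (\<integral>x. D x * indicator A x \<partial>M)"
      by (intro integral_nonneg_AE AE_I2) (simp add: D_nonneg)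
    moreover have "0 \<le> l (indicator A) + measure M A" using l_ind[OF A] by simp
    ultimately show ?thesis using eq by (simp only: ennreal_inj)
  qed
  define \<phi> where "\<phi> x = D x - 1" for x
  have \<phi>_meas[measurable]: "\<phi> \<in> borel_measurable M" unfolding \<phi>_def by measurable
  have \<phi>_ind: "(\<integral>x. \<phi> x * indicator A x \<partial>M) = l (indicator A)" if A: "A \<in> sets M" for A
  proof -
    have "(\<integral>x. \<phi> x * indicator A x \<partial>M) = (\<integral>x. D x * indicator A x - indicator A x \<partial>M)"
      unfolding \<phi>_def by (simp add: algebra_simps)
    also have "\<dots> = (\<integral>x. D x * indicator A x \<partial>M) - measure M A"
      using A int_D ind[OF A] by (subst Bochner_Integration.integral_diff) (auto intro: integrable_real_mult_indicator)
    finally show ?thesis using int_ind[OF A] by simp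
  qed
  have "AE x in M. D x \<le> 2"
    using int_ind l_ind by (intro AE_le_const_of_set_integrals int_D) fastforce
  then have bound: "AE x in M. \<bar>\<phi> x\<bar> \<le> 1"
  proof eventually_elim
    case (elim x)
    then show ?case using D_nonneg[of x] by (simp add: \<phi>_def abs_le_iff)
  qed
  have int_\<phi>: "integrable M (\<lambda>x. \<phi> x * f x)" if "integrable M f" for f
    using bound by (intro Bochner_Integration.integrable_bound[OF that])
      (use that in \<open>auto elim!: eventually_mono simp: abs_mult mult_left_le_one_le\<close>)
  have "l f = (\<integral>x. \<phi> x * f x \<partial>M)" if "integrable M f" for f
    using that
  proof (induction rule: integrable_induct)
    case (base A c)
    then have "l (\<lambda>x. c * indicator A x) = c * l (indicator A)" by (intro scale ind)
    also have "\<dots> = (\<integral>x. c * (\<phi> x * indicator A x) \<partial>M)" using \<phi>_ind[OF base(1)] by simp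
    finally show ?case by (simp add: mult.commute mult.left_commute)
  next
    case (add f g)
    then show ?case
      using assms(2)[OF add(1,2)] int_\<phi>[OF add(1)] int_\<phi>[OF add(2)] by (simp add: algebra_simps)
  next
    case (lim f s)
    have "(\<lambda>i. \<integral>x. \<phi> x * s i x \<partial>M) \<longlonglongrightarrow> (\<integral>x. \<phi> x * f x \<partial>M)"
    proof (rule integral_dominated_convergence[where w = "\<lambda>x. 2 * \<bar>f x\<bar>"])
      show "AE x in M. (\<lambda>i. \<phi> x * s i x) \<longlonglongrightarrow> \<phi> x * f x"
        using lim(2) by (intro AE_I2 tendsto_mult_left) auto
      show "AE x in M. norm (\<phi> x * s i x) \<le> 2 * \<bar>f x\<bar>" for i
        using bound AE_space
      proof eventually_elim
        case (elim x)
        have "\<bar>\<phi> x\<bar> * \<bar>s i x\<bar> \<le> 1 * \<bar>s i x\<bar>" using elim by (intro mult_right_mono) auto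
        then show ?case using lim(3)[OF elim(2), of i] by (simp add: abs_mult)
      qed
    qed (use lim(1,4) in auto)
    moreover have "(\<lambda>i. \<integral>x. \<phi> x * s i x \<partial>M) \<longlonglongrightarrow> l f"
    proof -
      have "(\<lambda>i. \<integral>x. \<bar>f x - s i x\<bar> \<partial>M) \<longlonglongrightarrow> (\<integral>x. 0 \<partial>M)"
      proof (rule integral_dominated_convergence[where w = "\<lambda>x. 3 * \<bar>f x\<bar>"])
        show "AE x in M. (\<lambda>i. \<bar>f x - s i x\<bar>) \<longlonglongrightarrow> 0"
        proof (rule AE_I2)
          fix x assume "x \<in> space M"
          then have "(\<lambda>i. \<bar>f x - s i x\<bar>) \<longlonglongrightarrow> \<bar>f x - f x\<bar>"
            by (intro tendsto_rabs tendsto_diff tendsto_const lim(2))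
          then show "(\<lambda>i. \<bar>f x - s i x\<bar>) \<longlonglongrightarrow> 0" by simp
        qed
        show "AE x in M. norm \<bar>f x - s i x\<bar> \<le> 3 * \<bar>f x\<bar>" for i
        proof (rule AE_I2)
          fix x assume "x \<in> space M"
          then have "\<bar>s i x\<bar> \<le> 2 * \<bar>f x\<bar>" using lim(3) by simp
          then show "norm \<bar>f x - s i x\<bar> \<le> 3 * \<bar>f x\<bar>"
            using abs_triangle_ineq4[of "f x" "s i x"] by simp
        qed
      qed (use lim(1,4) in auto)
      then have L: "(\<lambda>i. \<integral>x. \<bar>f x - s i x\<bar> \<partial>M) \<longlonglongrightarrow> 0" by simp
      have "\<bar>l f - l (s i)\<bar> \<le> (\<integral>x. \<bar>f x - s i x\<bar> \<partial>M)" for i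
        using abs_le[of "\<lambda>x. f x - s i x"] diff[OF lim(4) lim(1)] lim(1,4) by simp
      then have "(\<lambda>i. l f - l (s i)) \<longlonglongrightarrow> 0"
        by (intro tendsto_0_le[OF L, of _ 1] always_eventually) (auto intro: order_trans[OF _ abs_ge_self])
      then have "(\<lambda>i. l f - (l f - l (s i))) \<longlonglongrightarrow> l f - 0" by (intro tendsto_diff tendsto_const)
      then show ?thesis by (simp add: lim(5))
    qed
    ultimately show ?case by (rule LIMSEQ_unique[symmetric])
  qed
  then show ?thesis using that \<phi>_meas bound by blast
qed

text \<open>
  Take a linear functional below the distance from \<open>D\<close> that attains this distance at \<open>f0\<close>. It vanishes
  on \<open>D\<close>, since the distance does, it is positive at \<open>f0\<close>, and it is bounded by the \<open>L\<^sub>1\<close> norm.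
\<close>

theorem L1_annihilator_exists:
  assumes "finite_measure M"
    and D: "function_space D" "\<And>d. d \<in> D \<Longrightarrow> integrable M d"
    and f0: "integrable M f0" and e: "0 < e" "\<And>d. d \<in> D \<Longrightarrow> e \<le> (\<integral>x. \<bar>f0 x - d x\<bar> \<partial>M)"
  obtains \<phi> where "\<phi> \<in> borel_measurable M" "AE x in M. \<bar>\<phi> x\<bar> \<le> 1"
    "\<And>d. d \<in> D \<Longrightarrow> (\<integral>x. \<phi> x * d x \<partial>M) = 0" "(\<integral>x. \<phi> x * f0 x \<partial>M) \<noteq> 0"
proof -
  interpret finite_measure M by fact
  let ?V = "{f. integrable M f} :: ('a \<Rightarrow> real) set"
  define q where "q f = (INF d\<in>D. \<integral>x. \<bar>f x - d x\<bar> \<partial>M)" for f :: "'a \<Rightarrow> real"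
  have "D \<noteq> {}" using function_spaceD(1)[OF D(1)] by auto
  have V: "function_space ?V" unfolding function_space_def by auto
  have q_le: "q f \<le> (\<integral>x. \<bar>f x - d x\<bar> \<partial>M)" if "d \<in> D" for f d
    unfolding q_def using that by (intro cINF_lower bdd_belowI2[of _ 0]) auto
  have q_ge: "c \<le> q f" if "\<And>d. d \<in> D \<Longrightarrow> c \<le> (\<integral>x. \<bar>f x - d x\<bar> \<partial>M)" for c f
    unfolding q_def using that \<open>D \<noteq> {}\<close> by (intro cINF_greatest)
  have q_add: "q (\<lambda>x. f x + g x) \<le> q f + q g" if f: "integrable M f" and g: "integrable M g" for f g
  proof -
    have "q (\<lambda>x. f x + g x) \<le> (\<integral>x. \<bar>f x - d x\<bar> \<partial>M) + (\<integral>x. \<bar>g x - c x\<bar> \<partial>M)"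
      if d: "d \<in> D" and c: "c \<in> D" for d c
    proof -
      have "q (\<lambda>x. f x + g x) \<le> (\<integral>x. \<bar>(f x + g x) - (d x + c x)\<bar> \<partial>M)"
        by (intro q_le function_spaceD(2)[OF D(1)] d c)
      also have "\<dots> \<le> (\<integral>x. \<bar>f x - d x\<bar> + \<bar>g x - c x\<bar> \<partial>M)"
        using f g D(2)[OF d] D(2)[OF c] by (intro integral_mono) auto
      also have "\<dots> = (\<integral>x. \<bar>f x - d x\<bar> \<partial>M) + (\<integral>x. \<bar>g x - c x\<bar> \<partial>M)"
        using f g D(2)[OF d] D(2)[OF c] by (intro Bochner_Integration.integral_add) auto
      finally show ?thesis .
    qed
    then have "q (\<lambda>x. f x + g x) - (\<integral>x. \<bar>g x - c x\<bar> \<partial>M) \<le> q f" if "c \<in> D" for c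
      using that by (intro q_ge) (simp add: algebra_simps)
    then have "q (\<lambda>x. f x + g x) - q f \<le> q g"
      by (intro q_ge) (simp add: algebra_simps)
    then show ?thesis by simp
  qed
  have q_scale: "q (\<lambda>x. a * f x) = a * q f" if a: "a \<ge> 0" for a f
  proof (cases "a = 0")
    case True
    have "q (\<lambda>x. 0) \<le> 0" using q_le[OF function_spaceD(1)[OF D(1)], of "\<lambda>x. 0"] by simp
    moreover have "0 \<le> q (\<lambda>x. 0)" by (intro q_ge) auto
    ultimately show ?thesis using True by simp
  next
    case False
    then have "a > 0" using a by simp
    have pull: "(\<integral>x. \<bar>a * f x - a * d x\<bar> \<partial>M) = a * (\<integral>x. \<bar>f x - d x\<bar> \<partial>M)" for d
      using a by (simp add: abs_mult flip: right_diff_distrib)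
    have "q (\<lambda>x. a * f x) / a \<le> q f"
    proof (rule q_ge)
      fix d assume "d \<in> D"
      from q_le[OF function_spaceD(3)[OF D(1) this, of a], of "\<lambda>x. a * f x"]
      show "q (\<lambda>x. a * f x) / a \<le> (\<integral>x. \<bar>f x - d x\<bar> \<partial>M)"
        using \<open>a > 0\<close> unfolding pull by (simp add: field_simps)
    qed
    moreover have "a * q f \<le> q (\<lambda>x. a * f x)"
    proof (rule q_ge)
      fix d assume "d \<in> D"
      then have "a * q f \<le> a * (\<integral>x. \<bar>f x - inverse a * d x\<bar> \<partial>M)"
        by (intro mult_left_mono a q_le function_spaceD(3)[OF D(1)])
      then show "a * q f \<le> (\<integral>x. \<bar>a * f x - d x\<bar> \<partial>M)"
        using \<open>a > 0\<close> unfolding pull[symmetric] by (simp flip: mult.assoc)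
    qed
    ultimately show ?thesis using \<open>a > 0\<close> by (intro antisym) (simp_all add: field_simps)
  qed
  have q: "sublinear_on ?V q"
    unfolding sublinear_on_def using q_add q_scale by simp
  obtain l where l: "\<And>f g. f \<in> ?V \<Longrightarrow> g \<in> ?V \<Longrightarrow> l (\<lambda>x. f x + g x) = l f + l g"
    "\<And>f a. f \<in> ?V \<Longrightarrow> l (\<lambda>x. a * f x) = a * l f" "\<And>f. f \<in> ?V \<Longrightarrow> l f \<le> q f" "l f0 = q f0"
    using Hahn_Banach_function_space[OF V q, of f0] f0 by blast
  have l_le: "l f \<le> (\<integral>x. \<bar>f x\<bar> \<partial>M)" if "integrable M f" for f
    using l(3)[of f] q_le[OF function_spaceD(1)[OF D(1)], of f] that by simp
  obtain \<phi> where \<phi>: "\<phi> \<in> borel_measurable M" "AE x in M. \<bar>\<phi> x\<bar> \<le> 1"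
    "\<And>f. integrable M f \<Longrightarrow> l f = (\<integral>x. \<phi> x * f x \<partial>M)"
    by (rule L1_functional_represented[OF \<open>finite_measure M\<close>, of l]) (use l(1,2) l_le that in auto)
  have l_D: "l d \<le> 0" if d: "d \<in> D" for d
    using l(3)[of d] D(2)[OF d] q_le[OF d, of d] by simp
  show ?thesis
  proof
    fix d assume d: "d \<in> D"
    have "- l d \<le> 0" using l_D[OF function_spaceD(3)[OF D(1) d, of "- 1"]] l(2)[of d "- 1"] D(2)[OF d] by simp
    then show "(\<integral>x. \<phi> x * d x \<partial>M) = 0" using l_D[OF d] \<phi>(3)[OF D(2)[OF d]] by simp
  next
    have "e \<le> l f0" unfolding l(4) using e(2) by (rule q_ge)
    then show "(\<integral>x. \<phi> x * f0 x \<partial>M) \<noteq> 0" using e(1) \<phi>(3)[OF f0] by simp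
  qed (use \<phi> in auto)
qed

section \<open>Equivariant images and perturbations of invariant measures\<close>

instance prod :: (polish_space, polish_space) polish_space ..

lemma diagonal_action_components [simp]:
  "fst (diagonal_action \<alpha>\<^sub>1 \<alpha>\<^sub>2 g z) = \<alpha>\<^sub>1 g (fst z)"
  "snd (diagonal_action \<alpha>\<^sub>1 \<alpha>\<^sub>2 g z) = \<alpha>\<^sub>2 g (snd z)"
  by (simp_all add: diagonal_action_def case_prod_beta)

lemma measurable_action_diagonal_action:
  assumes "measurable_action \<alpha>\<^sub>1" "measurable_action \<alpha>\<^sub>2"
  shows "measurable_action (diagonal_action \<alpha>\<^sub>1 \<alpha>\<^sub>2)"
  unfolding measurable_action_def
proof (intro conjI allI)
  show "diagonal_action \<alpha>\<^sub>1 \<alpha>\<^sub>2 0 x = x" for x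
    by (simp add: diagonal_action_def case_prod_beta measurable_actionD(1)[OF assms(1)]
        measurable_actionD(1)[OF assms(2)])
  show "diagonal_action \<alpha>\<^sub>1 \<alpha>\<^sub>2 (g + h) x = diagonal_action \<alpha>\<^sub>1 \<alpha>\<^sub>2 g (diagonal_action \<alpha>\<^sub>1 \<alpha>\<^sub>2 h x)" for g h x
    by (simp add: diagonal_action_def case_prod_beta measurable_actionD(2)[OF assms(1)]
        measurable_actionD(2)[OF assms(2)])
  have [measurable]: "(\<lambda>p. \<alpha>\<^sub>1 (fst p) (snd p)) \<in> borel \<Otimes>\<^sub>M borel \<rightarrow>\<^sub>M borel"
    "(\<lambda>p. \<alpha>\<^sub>2 (fst p) (snd p)) \<in> borel \<Otimes>\<^sub>M borel \<rightarrow>\<^sub>M borel"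
    using measurable_actionD(3)[OF assms(1)] measurable_actionD(3)[OF assms(2)]
    by (simp_all add: case_prod_beta)
  show "(\<lambda>(g, x). diagonal_action \<alpha>\<^sub>1 \<alpha>\<^sub>2 g x) \<in> borel \<Otimes>\<^sub>M borel \<rightarrow>\<^sub>M borel"
    unfolding diagonal_action_def case_prod_beta borel_prod[symmetric]
    by (rule measurable_Pair)
       (rule measurable_compose[of "\<lambda>p. (fst p, fst (snd p))" _ "borel \<Otimes>\<^sub>M borel" "\<lambda>p. \<alpha>\<^sub>1 (fst p) (snd p)", simplified]
             measurable_compose[of "\<lambda>p. (fst p, snd (snd p))" _ "borel \<Otimes>\<^sub>M borel" "\<lambda>p. \<alpha>\<^sub>2 (fst p) (snd p)", simplified]; measurable)+
qed

lemma measurable_invariant_algebra_equivariant: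
  fixes \<pi> :: "'z::topological_space \<Rightarrow> 'x::topological_space" and f :: "'x \<Rightarrow> real"
  assumes "\<pi> \<in> borel \<rightarrow>\<^sub>M borel" "\<And>g z. \<pi> (\<delta> g z) = \<alpha> g (\<pi> z)"
    and f: "f \<in> borel_measurable (invariant_algebra \<alpha>)"
  shows "(\<lambda>z. f (\<pi> z)) \<in> borel_measurable (invariant_algebra \<delta>)"
proof (rule borel_measurable_invariant_algebraI)
  show "(\<lambda>z. f (\<pi> z)) \<in> borel_measurable borel"
    using borel_measurable_invariant_algebraD(1)[OF f] assms(1) by measurable
  show "f (\<pi> (\<delta> g z)) = f (\<pi> z)" for g z
    by (simp add: assms(2) borel_measurable_invariant_algebraD(2)[OF f])
qed

lemma invariant_measure_equivariant_image:
  assumes \<pi>: "\<pi> \<in> borel \<rightarrow>\<^sub>M borel" "\<And>g z. \<pi> (\<delta> g z) = \<alpha> g (\<pi> z)"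
    and \<alpha>: "\<And>g. \<alpha> g \<in> borel \<rightarrow>\<^sub>M borel" and \<delta>: "\<And>g. \<delta> g \<in> borel \<rightarrow>\<^sub>M borel"
    and Q: "sets Q = sets borel" "invariant_measure \<delta> Q"
  shows "invariant_measure \<alpha> (distr Q borel \<pi>)"
  unfolding invariant_measure_def
proof
  fix g
  have [measurable_cong]: "sets Q = sets borel" by fact
  note [measurable] = \<pi>(1) \<alpha> \<delta>
  have "distr (distr Q borel \<pi>) borel (\<alpha> g) = distr Q borel (\<lambda>z. \<alpha> g (\<pi> z))"
    by (subst distr_distr) (auto simp: comp_def)
  also have "\<dots> = distr Q borel (\<lambda>z. \<pi> (\<delta> g z))" by (simp add: \<pi>(2))
  also have "\<dots> = distr (distr Q borel (\<delta> g)) borel \<pi>"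
    by (subst distr_distr) (auto simp: comp_def)
  also have "distr Q borel (\<delta> g) = Q" using Q(2) by (simp add: invariant_measure_def)
  finally show "distr (distr Q borel \<pi>) borel (\<alpha> g) = distr Q borel \<pi>" .
qed

lemma invariant_measure_density:
  assumes \<delta>: "\<And>g. \<delta> g \<in> borel \<rightarrow>\<^sub>M borel" and P: "sets P = sets borel" "invariant_measure \<delta> P"
    and h: "h \<in> borel_measurable (invariant_algebra \<delta>)"
  shows "invariant_measure \<delta> (density P (\<lambda>z. ennreal (h z)))"
  unfolding invariant_measure_def
proof
  fix g
  have [measurable_cong]: "sets P = sets borel" by fact
  note [measurable] = \<delta> borel_measurable_invariant_algebraD(1)[OF h]
  have "distr (density P (\<lambda>z. ennreal (h z))) borel (\<delta> g)
      = distr (density P (\<lambda>z. ennreal (h (\<delta> g z)))) borel (\<delta> g)"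
    by (simp add: borel_measurable_invariant_algebraD(2)[OF h])
  also have "\<dots> = density (distr P borel (\<delta> g)) (\<lambda>z. ennreal (h z))"
    by (rule density_distr[symmetric]) measurable
  also have "distr P borel (\<delta> g) = P" using P(2) by (simp add: invariant_measure_def)
  finally show "distr (density P (\<lambda>z. ennreal (h z))) borel (\<delta> g) = density P (\<lambda>z. ennreal (h z))" .
qed

context prob_space begin

lemma integrable_AE_bounded:
  fixes f :: "'a \<Rightarrow> real"
  assumes "f \<in> borel_measurable M" "AE x in M. \<bar>f x\<bar> \<le> C"
  shows "integrable M f"
  using assms by (intro integrable_const_bound[of _ C]) auto

lemma integrable_mult_AE_bounded:
  fixes f g :: "'a \<Rightarrow> real"
  assumes f: "f \<in> borel_measurable M" "AE x in M. \<bar>f x\<bar> \<le> C" and g: "integrable M g"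
  shows "integrable M (\<lambda>x. g x * f x)"
proof (rule Bochner_Integration.integrable_bound[of _ "\<lambda>x. C * g x"])
  show "AE x in M. norm (g x * f x) \<le> norm (C * g x)"
    using f(2)
  proof eventually_elim
    case (elim x)
    then have "\<bar>f x\<bar> * \<bar>g x\<bar> \<le> \<bar>C\<bar> * \<bar>g x\<bar>" by (intro mult_right_mono) auto
    then show ?case by (simp add: abs_mult mult.commute)
  qed
qed (use f g in auto)

text \<open>
  The move away from \<open>M\<close> in the direction \<open>f\<close>; it yields a measure with density \<open>1 + f/c\<close> when
  \<open>\<bar>f\<bar> \<le> c\<close>.
\<close>

definition perturbed :: "('a \<Rightarrow> real) \<Rightarrow> real \<Rightarrow> 'a measure" where
  "perturbed f c = density M (\<lambda>x. ennreal (1 + f x / c))"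

lemma sets_perturbed [simp]: "sets (perturbed f c) = sets M"
  and space_perturbed [simp]: "space (perturbed f c) = space M"
  by (simp_all add: perturbed_def)

lemma perturbed_mass:
  assumes f: "f \<in> borel_measurable M" "\<And>x. \<bar>f x\<bar> \<le> c" and c: "c > 0" and A: "A \<in> sets M"
  shows "emeasure (perturbed f c) A = ennreal (measure M A + (\<integral>x. f x * indicator A x \<partial>M) / c)"
    and "0 \<le> measure M A + (\<integral>x. f x * indicator A x \<partial>M) / c"
proof -
  have nonneg: "0 \<le> 1 + f x / c" for x
    using f(2)[of x] c by (simp add: field_simps abs_le_iff)
  have f_int: "integrable M (\<lambda>x. f x * indicator A x)"
    using f A by (intro integrable_real_mult_indicator integrable_AE_bounded[of _ c]) auto
  have ind_int: "integrable M (indicator A :: 'a \<Rightarrow> real)"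
    using A by (simp add: emeasure_eq_measure)
  have "(\<integral>x. (1 + f x / c) * indicator A x \<partial>M)
      = (\<integral>x. indicator A x + (f x * indicator A x) / c \<partial>M)"
    by (simp add: algebra_simps)
  also have "\<dots> = measure M A + (\<integral>x. f x * indicator A x \<partial>M) / c"
    using A f_int ind_int by (subst Bochner_Integration.integral_add) auto
  finally have int: "(\<integral>x. (1 + f x / c) * indicator A x \<partial>M)
      = measure M A + (\<integral>x. f x * indicator A x \<partial>M) / c" .
  show "0 \<le> measure M A + (\<integral>x. f x * indicator A x \<partial>M) / c"
    unfolding int[symmetric] by (intro integral_nonneg_AE AE_I2 mult_nonneg_nonneg nonneg) simp
  have "integrable M f" using f by (intro integrable_AE_bounded[of _ c]) auto
  then have "integrable M (\<lambda>x. (1 + f x / c) * indicator A x)"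
    using A by (intro integrable_real_mult_indicator) auto
  then have "ennreal (\<integral>x. (1 + f x / c) * indicator A x \<partial>M)
      = (\<integral>\<^sup>+x. ennreal ((1 + f x / c) * indicator A x) \<partial>M)"
    by (intro nn_integral_eq_integral[symmetric] AE_I2 mult_nonneg_nonneg nonneg) auto
  also have "\<dots> = emeasure (perturbed f c) A"
    unfolding perturbed_def using A f(1)
    by (auto simp: emeasure_density intro!: nn_integral_cong split: split_indicator)
  finally show "emeasure (perturbed f c) A = ennreal (measure M A + (\<integral>x. f x * indicator A x \<partial>M) / c)"
    unfolding int ..
qed

text \<open>
  The sets of the \<open>\<sigma>\<close>-algebra generated by \<open>X\<close> are the preimages of Borel sets under \<open>X\<close>.
\<close>

lemma integral_mult_eq_0_iff_cond_exp_eq_0: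
  fixes X :: "'a \<Rightarrow> 'x::topological_space" and Y :: "'a \<Rightarrow> real"
  assumes X: "X \<in> M \<rightarrow>\<^sub>M borel" and Y: "integrable M Y"
  shows "(AE w in M. real_cond_exp M (vimage_algebra (space M) X borel) Y w = 0) \<longleftrightarrow>
    (\<forall>B\<in>sets borel. (\<integral>w. Y w * indicator B (X w) \<partial>M) = 0)"
    (is "?L \<longleftrightarrow> ?R")
proof -
  let ?F = "vimage_algebra (space M) X borel"
  have X': "X \<in> space M \<rightarrow> space borel" by simp
  have sets_F: "sets ?F = {X -` B \<inter> space M | B. B \<in> sets borel}"
    using sets_vimage_algebra2[OF X'] by simp
  have "subalgebra M ?F"
    unfolding subalgebra_def using measurable_sets[OF X] by (auto simp: sets_F)
  then interpret finite_measure_subalgebra M ?F by unfold_locales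
  have ind: "(\<integral>w. Y w * indicator B (X w) \<partial>M) = (\<integral>w\<in>X -` B \<inter> space M. Y w \<partial>M)" for B
    unfolding set_lebesgue_integral_def
    by (intro Bochner_Integration.integral_cong) (auto split: split_indicator)
  show ?thesis
  proof
    assume L: ?L
    show ?R
    proof
      fix B :: "'x set" assume "B \<in> sets borel"
      then have A: "X -` B \<inter> space M \<in> sets ?F" unfolding sets_F by blast
      have "(\<integral>w\<in>X -` B \<inter> space M. Y w \<partial>M) = (\<integral>w\<in>X -` B \<inter> space M. real_cond_exp M ?F Y w \<partial>M)"
        by (rule real_cond_exp_intA[OF Y A])
      also have "\<dots> = (\<integral>w. 0 \<partial>M)"
        unfolding set_lebesgue_integral_def using L measurable_sets[OF X \<open>B \<in> sets borel\<close>]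
        by (intro integral_cong_AE) (auto elim!: eventually_mono)
      finally show "(\<integral>w. Y w * indicator B (X w) \<partial>M) = 0" unfolding ind by simp
    qed
  next
    assume R: ?R
    show ?L
    proof (rule real_cond_exp_charact)
      fix A assume "A \<in> sets ?F"
      then obtain B where "A = X -` B \<inter> space M" "B \<in> sets borel" unfolding sets_F by blast
      then show "(\<integral>w\<in>A. Y w \<partial>M) = (\<integral>w\<in>A. 0 \<partial>M)" using R ind[of B] by simp
    qed (use Y in auto)
  qed
qed

text \<open>
  The assumption on indicators says that the conditional expectation of \<open>Y\<close> given \<open>X\<close> vanishes, and
  conditioning does not change the integral of \<open>Y\<close> against a function of \<open>X\<close>.
\<close>

lemma integral_mult_compose_eq_0:
  fixes X :: "'a \<Rightarrow> 'x::topological_space" and Y :: "'a \<Rightarrow> real"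
  assumes X: "X \<in> M \<rightarrow>\<^sub>M borel" and Y: "Y \<in> borel_measurable M" "AE w in M. \<bar>Y w\<bar> \<le> C"
    and 0: "\<And>B. B \<in> sets borel \<Longrightarrow> (\<integral>w. Y w * indicator B (X w) \<partial>M) = 0"
    and g: "g \<in> borel_measurable borel" "integrable M (\<lambda>w. g (X w))"
  shows "(\<integral>w. g (X w) * Y w \<partial>M) = 0"
proof -
  let ?F = "vimage_algebra (space M) X borel"
  have X': "X \<in> space M \<rightarrow> space borel" by simp
  have "subalgebra M ?F"
    unfolding subalgebra_def using measurable_sets[OF X] by (auto simp: sets_vimage_algebra2[OF X'])
  then interpret finite_measure_subalgebra M ?F by unfold_locales
  have Y_int: "integrable M Y" by (rule integrable_AE_bounded[OF Y])
  have ce: "AE w in M. real_cond_exp M ?F Y w = 0"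
    using integral_mult_eq_0_iff_cond_exp_eq_0[OF X Y_int] 0 by simp
  have "(\<lambda>w. g (X w)) \<in> borel_measurable ?F"
    by (rule measurable_compose[OF measurable_vimage_algebra1[OF X'] g(1)])
  then have "(\<integral>w. g (X w) * Y w \<partial>M) = (\<integral>w. g (X w) * real_cond_exp M ?F Y w \<partial>M)"
    using integrable_mult_AE_bounded[OF Y g(2)] Y(1)
    by (intro real_cond_exp_intg(2)[symmetric]) auto
  also have "\<dots> = (\<integral>w. 0 \<partial>M)"
    using ce g(2) by (intro integral_cong_AE) (auto elim!: eventually_mono)
  finally show ?thesis by simp
qed

end

text \<open>
  The images of \<open>P\<close> and of \<open>(1 + f/c) P\<close> under the equivariant map \<open>\<pi>\<close> are invariant measures, and by
  assumption they agree on invariant sets. Hence they are equal.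
\<close>

lemma orthogonal_to_invariant_sets_imp_all_sets:
  fixes \<alpha> :: "'g::{topological_group_add, polish_space} \<Rightarrow> 'x::polish_space \<Rightarrow> 'x"
    and \<delta> :: "'g \<Rightarrow> 'z::polish_space \<Rightarrow> 'z" and f :: "'z \<Rightarrow> real"
  assumes lc: "locally_compact_space (euclidean :: 'g topology)"
    and \<alpha>: "measurable_action \<alpha>" and \<delta>: "measurable_action \<delta>"
    and \<pi>: "\<pi> \<in> borel \<rightarrow>\<^sub>M borel" "\<And>g z. \<pi> (\<delta> g z) = \<alpha> g (\<pi> z)"
    and P: "prob_space P" "sets P = sets borel" "invariant_measure \<delta> P"
    and f: "f \<in> borel_measurable (invariant_algebra \<delta>)" "\<And>z. \<bar>f z\<bar> \<le> c" and c: "c > 0"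
    and orth: "\<And>A. A \<in> sets (invariant_algebra \<alpha>) \<Longrightarrow> (\<integral>z. f z * indicator A (\<pi> z) \<partial>P) = 0"
    and B: "B \<in> sets borel"
  shows "(\<integral>z. f z * indicator B (\<pi> z) \<partial>P) = 0"
proof -
  interpret prob_space P by fact
  have space: "space P = UNIV" using sets_eq_imp_space_eq[OF P(2)] by simp
  have \<pi>P: "\<pi> \<in> P \<rightarrow>\<^sub>M borel" using \<pi>(1) by (simp add: measurable_cong_sets[OF P(2) refl])
  have fP: "f \<in> borel_measurable P"
    using borel_measurable_invariant_algebraD(1)[OF f(1)] by (simp add: measurable_cong_sets[OF P(2) refl])
  define Q where "Q = perturbed f c"
  have sets_Q: "sets Q = sets borel" unfolding Q_def by (simp add: P(2))
  have \<pi>Q: "\<pi> \<in> Q \<rightarrow>\<^sub>M borel" using \<pi>(1) by (simp add: measurable_cong_sets[OF sets_Q refl])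
  have image: "emeasure (distr Q borel \<pi>) A
      = ennreal (measure (distr P borel \<pi>) A + (\<integral>z. f z * indicator A (\<pi> z) \<partial>P) / c)"
    and image_nonneg: "0 \<le> measure (distr P borel \<pi>) A + (\<integral>z. f z * indicator A (\<pi> z) \<partial>P) / c"
    if A: "A \<in> sets borel" for A
  proof -
    have A': "\<pi> -` A \<in> sets P" using measurable_sets[OF \<pi>P A] by (simp add: space)
    have "(indicator (\<pi> -` A) :: _ \<Rightarrow> real) = (\<lambda>z. indicator A (\<pi> z))"
      by (auto simp: fun_eq_iff split: split_indicator)
    with perturbed_mass[OF fP f(2) c A']
    show "emeasure (distr Q borel \<pi>) A
        = ennreal (measure (distr P borel \<pi>) A + (\<integral>z. f z * indicator A (\<pi> z) \<partial>P) / c)"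
      and "0 \<le> measure (distr P borel \<pi>) A + (\<integral>z. f z * indicator A (\<pi> z) \<partial>P) / c"
      using A by (simp_all add: emeasure_distr[OF \<pi>Q[unfolded Q_def] A] measure_distr[OF \<pi>P A] space Q_def)
  qed
  interpret \<mu>: prob_space "distr P borel \<pi>" by (rule prob_space_distr[OF \<pi>P])
  have inv_Q: "invariant_measure \<delta> Q"
    unfolding Q_def perturbed_def using f(1)
    by (intro invariant_measure_density measurable_actionD(4)[OF \<delta>] P) auto
  have "distr Q borel \<pi> = distr P borel \<pi>"
  proof (rule invariant_measure_eqI[OF lc \<alpha>])
    show "finite_measure (distr P borel \<pi>)" by (rule \<mu>.finite_measure_axioms)
    show "finite_measure (distr Q borel \<pi>)"
      by (rule finite_measureI) (use image[of UNIV] in simp)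
    show "invariant_measure \<alpha> (distr P borel \<pi>)"
      by (rule invariant_measure_equivariant_image[OF \<pi> measurable_actionD(4)[OF \<alpha>]
            measurable_actionD(4)[OF \<delta>] P(2,3)])
    show "invariant_measure \<alpha> (distr Q borel \<pi>)"
      by (rule invariant_measure_equivariant_image[OF \<pi> measurable_actionD(4)[OF \<alpha>]
            measurable_actionD(4)[OF \<delta>] sets_Q inv_Q])
    show "absolutely_continuous (distr P borel \<pi>) (distr Q borel \<pi>)"
      unfolding absolutely_continuous_def
    proof
      fix A assume A: "A \<in> null_sets (distr P borel \<pi>)"
      then have "A \<in> sets borel" by auto
      have "AE x in distr P borel \<pi>. x \<notin> A" using A by (rule AE_not_in)
      then have "AE z in P. \<pi> z \<notin> A" by (rule AE_distrD[OF \<pi>P])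
      then have "(\<integral>z. f z * indicator A (\<pi> z) \<partial>P) = 0"
        by (intro integral_eq_zero_AE) (auto elim!: eventually_mono)
      then have "emeasure (distr Q borel \<pi>) A = emeasure (distr P borel \<pi>) A"
        using image[OF \<open>A \<in> sets borel\<close>] by (simp add: \<mu>.emeasure_eq_measure)
      then show "A \<in> null_sets (distr Q borel \<pi>)" using A by (auto simp: null_sets_def)
    qed
    fix A assume A: "A \<in> sets (invariant_algebra \<alpha>)"
    then have "A \<in> sets borel" by (simp add: sets_invariant_algebra)
    then show "emeasure (distr Q borel \<pi>) A = emeasure (distr P borel \<pi>) A"
      using image orth[OF A] by (simp add: \<mu>.emeasure_eq_measure)
  qed simp_all
  then have "ennreal (measure (distr P borel \<pi>) B + (\<integral>z. f z * indicator B (\<pi> z) \<partial>P) / c)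
      = ennreal (measure (distr P borel \<pi>) B)"
    using image[OF B] by (simp add: \<mu>.emeasure_eq_measure)
  then have "(\<integral>z. f z * indicator B (\<pi> z) \<partial>P) / c = 0"
    using image_nonneg[OF B] by (subst (asm) ennreal_inj) auto
  then show ?thesis using c by simp
qed

section \<open>Extremality of invariant couplings\<close>

lemma Linf_on_bounded_version:
  assumes "f \<in> Linf_on F M"
  obtains f' c where "f' \<in> borel_measurable F" "AE z in M. f z = f' z" "c > 0" "\<And>z. \<bar>f' z\<bar> \<le> c"
proof -
  obtain C f' where C: "AE z in M. \<bar>f z\<bar> \<le> C" and f': "f' \<in> borel_measurable F" "AE z in M. f z = f' z"
    using assms unfolding Linf_on_def by auto
  define c where "c = \<bar>C\<bar> + 1"
  have "(\<lambda>z. max (- c) (min c (f' z))) \<in> borel_measurable F" using f'(1) by measurable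
  moreover have "AE z in M. f z = max (- c) (min c (f' z))"
    using C f'(2) by eventually_elim (auto simp: c_def)
  moreover have "\<bar>max (- c) (min c (f' z))\<bar> \<le> c" for z by (auto simp: c_def)
  moreover have "c > 0" by (simp add: c_def)
  ultimately show ?thesis using that by blast
qed

lemma function_space_L1_on: "function_space (L1_on F M)"
  unfolding function_space_def
proof (intro conjI ballI allI)
  show "(\<lambda>_. 0) \<in> L1_on F M" unfolding L1_on_def by auto
  fix f assume "f \<in> L1_on F M"
  then obtain f' where f: "integrable M f" "f' \<in> borel_measurable F" "AE x in M. f x = f' x"
    unfolding L1_on_def by auto
  have "(\<lambda>x. a * f' x) \<in> borel_measurable F" "AE x in M. a * f x = a * f' x" for a
    using f by auto
  then show "(\<lambda>x. a * f x) \<in> L1_on F M" for a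
    unfolding L1_on_def using f(1) by (intro CollectI conjI bexI[of _ "\<lambda>x. a * f' x"]) auto
  fix g assume "g \<in> L1_on F M"
  then obtain g' where g: "integrable M g" "g' \<in> borel_measurable F" "AE x in M. g x = g' x"
    unfolding L1_on_def by auto
  have "(\<lambda>x. f' x + g' x) \<in> borel_measurable F" "AE x in M. f x + g x = f' x + g' x"
    using f g by auto
  then show "(\<lambda>x. f x + g x) \<in> L1_on F M"
    unfolding L1_on_def using f(1) g(1)
    by (intro CollectI conjI bexI[of _ "\<lambda>x. f' x + g' x"]) auto
qed

lemma indicator_in_L1_on:
  fixes \<alpha> :: "'g \<Rightarrow> 'x::topological_space \<Rightarrow> 'x"
  assumes "finite_measure M" "sets M = sets borel" "A \<in> sets (invariant_algebra \<alpha>)"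
  shows "(indicator A :: 'x \<Rightarrow> real) \<in> L1_on (invariant_algebra \<alpha>) M"
proof -
  interpret finite_measure M by fact
  have "A \<in> sets M" using assms(2,3) by (simp add: sets_invariant_algebra)
  then have "integrable M (indicator A :: 'x \<Rightarrow> real)" by (simp add: emeasure_eq_measure)
  moreover have "(indicator A :: 'x \<Rightarrow> real) \<in> borel_measurable (invariant_algebra \<alpha>)"
    using assms(3) by (rule borel_measurable_indicator)
  ultimately show ?thesis unfolding L1_on_def by blast
qed

lemma L1_on_compose_equivariant:
  fixes \<pi> :: "'z::topological_space \<Rightarrow> 'x::topological_space" and P :: "'z measure"
  assumes \<pi>: "\<pi> \<in> borel \<rightarrow>\<^sub>M borel" "\<And>g z. \<pi> (\<delta> g z) = \<alpha> g (\<pi> z)"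
    and P: "sets P = sets borel" "distr P borel \<pi> = Q"
    and g: "g \<in> L1_on (invariant_algebra \<alpha>) Q"
  shows "(\<lambda>z. g (\<pi> z)) \<in> L1_on (invariant_algebra \<delta>) P"
proof -
  have \<pi>P: "\<pi> \<in> P \<rightarrow>\<^sub>M borel" using \<pi>(1) by (simp add: measurable_cong_sets[OF P(1) refl])
  obtain g' where g': "integrable Q g" "g' \<in> borel_measurable (invariant_algebra \<alpha>)" "AE x in Q. g x = g' x"
    using g unfolding L1_on_def by auto
  have "integrable P (\<lambda>z. g (\<pi> z))"
    using g'(1) unfolding P(2)[symmetric] by (rule integrable_distr[OF \<pi>P])
  moreover have "AE z in P. g (\<pi> z) = g' (\<pi> z)"
    using g'(3) unfolding P(2)[symmetric] by (rule AE_distrD[OF \<pi>P])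
  moreover have "(\<lambda>z. g' (\<pi> z)) \<in> borel_measurable (invariant_algebra \<delta>)"
    by (rule measurable_invariant_algebra_equivariant[OF \<pi> g'(2)])
  ultimately show ?thesis
    unfolding L1_on_def by (intro CollectI conjI bexI[of _ "\<lambda>z. g' (\<pi> z)"])
qed

lemma invariant_couplingsD:
  assumes "P \<in> invariant_couplings \<alpha>\<^sub>1 \<alpha>\<^sub>2 P\<^sub>1 P\<^sub>2"
  shows "prob_space P" "sets P = sets borel" "distr P borel fst = P\<^sub>1" "distr P borel snd = P\<^sub>2"
    "invariant_measure (diagonal_action \<alpha>\<^sub>1 \<alpha>\<^sub>2) P"
  using assms unfolding invariant_couplings_def couplings_def by auto

locale invariant_coupling =
  fixes \<alpha>\<^sub>1 :: "'g::{topological_group_add, polish_space} \<Rightarrow> 'a::polish_space \<Rightarrow> 'a"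
    and \<alpha>\<^sub>2 :: "'g \<Rightarrow> 'b::polish_space \<Rightarrow> 'b"
    and P\<^sub>1 :: "'a measure" and P\<^sub>2 :: "'b measure" and P :: "('a \<times> 'b) measure"
  assumes lc: "locally_compact_space (euclidean :: 'g topology)"
    and act1: "measurable_action \<alpha>\<^sub>1" and act2: "measurable_action \<alpha>\<^sub>2"
    and P: "P \<in> invariant_couplings \<alpha>\<^sub>1 \<alpha>\<^sub>2 P\<^sub>1 P\<^sub>2"
begin

abbreviation "\<delta> \<equiv> diagonal_action \<alpha>\<^sub>1 \<alpha>\<^sub>2"
abbreviation "\<Sigma> \<equiv> invariant_algebra (diagonal_action \<alpha>\<^sub>1 \<alpha>\<^sub>2)"
abbreviation "\<Lambda> \<equiv> invariant_couplings \<alpha>\<^sub>1 \<alpha>\<^sub>2 P\<^sub>1 P\<^sub>2"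

sublocale prob_space P by (rule invariant_couplingsD(1)[OF P])

lemmas P_facts = invariant_couplingsD[OF P]
lemmas act = measurable_action_diagonal_action[OF act1 act2]

lemma space_P: "space P = UNIV"
  using sets_eq_imp_space_eq[OF P_facts(2)] by simp

lemma subalgebra_\<Sigma>: "subalgebra P \<Sigma>"
  by (auto simp: subalgebra_def space_P P_facts(2) sets_invariant_algebra)

lemma borel_measurable_\<Sigma>_P: "f \<in> borel_measurable \<Sigma> \<Longrightarrow> f \<in> borel_measurable P"
  by (rule measurable_from_subalg[OF subalgebra_\<Sigma>])

lemma fst_borel: "(fst :: 'a \<times> 'b \<Rightarrow> 'a) \<in> borel \<rightarrow>\<^sub>M borel"
  and snd_borel: "(snd :: 'a \<times> 'b \<Rightarrow> 'b) \<in> borel \<rightarrow>\<^sub>M borel"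
  by (simp_all flip: borel_prod)

lemma fst_P: "fst \<in> P \<rightarrow>\<^sub>M borel" and snd_P: "snd \<in> P \<rightarrow>\<^sub>M borel"
  using fst_borel snd_borel by (simp_all add: measurable_cong_sets[OF P_facts(2) refl])

definition invariant_sums :: "('a \<times> 'b \<Rightarrow> real) set" where
  "invariant_sums = {\<lambda>(x, y). g\<^sub>1 x + g\<^sub>2 y | g\<^sub>1 g\<^sub>2. g\<^sub>1 \<in> L1_on (invariant_algebra \<alpha>\<^sub>1) P\<^sub>1 \<and>
      g\<^sub>2 \<in> L1_on (invariant_algebra \<alpha>\<^sub>2) P\<^sub>2}"

definition orthogonal_to_sums :: "('a \<times> 'b \<Rightarrow> real) \<Rightarrow> bool" where
  "orthogonal_to_sums f \<longleftrightarrow> (\<forall>g\<^sub>1\<in>L1_on (invariant_algebra \<alpha>\<^sub>1) P\<^sub>1. \<forall>g\<^sub>2\<in>L1_on (invariant_algebra \<alpha>\<^sub>2) P\<^sub>2.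
      (\<integral>z. (g\<^sub>1 (fst z) + g\<^sub>2 (snd z)) * f z \<partial>P) = 0)"

text \<open>
  The signed measure \<open>f P\<close> has null marginals. All the conditions on \<open>f\<close> in the theorem are compared
  with this one.
\<close>

definition null_marginals :: "('a \<times> 'b \<Rightarrow> real) \<Rightarrow> bool" where
  "null_marginals f \<longleftrightarrow> (\<forall>B\<in>sets borel. (\<integral>z. f z * indicator B (fst z) \<partial>P) = 0) \<and>
     (\<forall>B\<in>sets borel. (\<integral>z. f z * indicator B (snd z) \<partial>P) = 0)"

lemma invariant_sums_iff: "d \<in> invariant_sums \<longleftrightarrow> (\<exists>g\<^sub>1\<in>L1_on (invariant_algebra \<alpha>\<^sub>1) P\<^sub>1. \<exists>g\<^sub>2\<in>L1_on (invariant_algebra \<alpha>\<^sub>2) P\<^sub>2.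
    d = (\<lambda>z. g\<^sub>1 (fst z) + g\<^sub>2 (snd z)))"
  unfolding invariant_sums_def mem_Collect_eq case_prod_beta' by blast

lemma L1_on_fst: "g \<in> L1_on (invariant_algebra \<alpha>\<^sub>1) P\<^sub>1 \<Longrightarrow> (\<lambda>z. g (fst z)) \<in> L1_on \<Sigma> P"
  by (rule L1_on_compose_equivariant[OF fst_borel _ P_facts(2,3)]) auto

lemma L1_on_snd: "g \<in> L1_on (invariant_algebra \<alpha>\<^sub>2) P\<^sub>2 \<Longrightarrow> (\<lambda>z. g (snd z)) \<in> L1_on \<Sigma> P"
  by (rule L1_on_compose_equivariant[OF snd_borel _ P_facts(2,4)]) auto

lemma invariant_sums_subset: "invariant_sums \<subseteq> L1_on \<Sigma> P"
proof
  fix d assume "d \<in> invariant_sums"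
  then obtain g1 g2 where "g1 \<in> L1_on (invariant_algebra \<alpha>\<^sub>1) P\<^sub>1" "g2 \<in> L1_on (invariant_algebra \<alpha>\<^sub>2) P\<^sub>2"
    and d: "d = (\<lambda>z. g1 (fst z) + g2 (snd z))" unfolding invariant_sums_iff by blast
  then show "d \<in> L1_on \<Sigma> P"
    unfolding d by (intro function_spaceD(2)[OF function_space_L1_on] L1_on_fst L1_on_snd)
qed

lemma function_space_invariant_sums: "function_space invariant_sums"
  unfolding function_space_def
proof (intro conjI ballI allI)
  note L1 = function_spaceD[OF function_space_L1_on]
  show "(\<lambda>_. 0) \<in> invariant_sums"
    unfolding invariant_sums_iff by (intro bexI[of _ "\<lambda>_. 0"] L1(1)) simp
  fix d assume "d \<in> invariant_sums"
  then obtain g1 g2 where g: "g1 \<in> L1_on (invariant_algebra \<alpha>\<^sub>1) P\<^sub>1" "g2 \<in> L1_on (invariant_algebra \<alpha>\<^sub>2) P\<^sub>2"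
    "d = (\<lambda>z. g1 (fst z) + g2 (snd z))" unfolding invariant_sums_iff by blast
  show "(\<lambda>z. a * d z) \<in> invariant_sums" for a
    unfolding invariant_sums_iff
    by (intro bexI[of _ "\<lambda>x. a * g1 x"] bexI[of _ "\<lambda>x. a * g2 x"] L1(3) g) (simp add: g(3) algebra_simps)
  fix e assume "e \<in> invariant_sums"
  then obtain h1 h2 where h: "h1 \<in> L1_on (invariant_algebra \<alpha>\<^sub>1) P\<^sub>1" "h2 \<in> L1_on (invariant_algebra \<alpha>\<^sub>2) P\<^sub>2"
    "e = (\<lambda>z. h1 (fst z) + h2 (snd z))" unfolding invariant_sums_iff by blast
  show "(\<lambda>z. d z + e z) \<in> invariant_sums"
    unfolding invariant_sums_iff
    by (intro bexI[of _ "\<lambda>x. g1 x + h1 x"] bexI[of _ "\<lambda>x. g2 x + h2 x"] L1(2) g h)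
       (simp add: g(3) h(3) algebra_simps)
qed

lemma marginals: "prob_space P\<^sub>1" "sets P\<^sub>1 = sets borel" "prob_space P\<^sub>2" "sets P\<^sub>2 = sets borel"
  using prob_space_distr[OF fst_P] prob_space_distr[OF snd_P] P_facts(3,4) by auto

lemma null_marginals_cong:
  assumes "f \<in> borel_measurable P" "f' \<in> borel_measurable P" "AE z in P. f z = f' z"
  shows "null_marginals f \<longleftrightarrow> null_marginals f'"
proof -
  have *: "(\<integral>z. f z * indicator B (\<pi> z) \<partial>P) = (\<integral>z. f' z * indicator B (\<pi> z) \<partial>P)"
    if "\<pi> \<in> P \<rightarrow>\<^sub>M borel" "B \<in> sets borel" for B and \<pi> :: "'a \<times> 'b \<Rightarrow> 'x::topological_space"
  proof -
    have "(\<lambda>z. indicator B (\<pi> z) :: real) \<in> borel_measurable P"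
      using that(2) by (intro measurable_compose[OF that(1)] borel_measurable_indicator)
    with assms show ?thesis by (intro integral_cong_AE borel_measurable_times) auto
  qed
  show ?thesis unfolding null_marginals_def using *[OF fst_P] *[OF snd_P] by simp
qed

text \<open>
  Orthogonality gives \<open>f\<close> zero integrals over the sets that are defined by one coordinate being in an
  invariant set. That one may drop the word invariant is
  \<open>orthogonal_to_invariant_sets_imp_all_sets\<close>, applied to the two coordinate maps.
\<close>

lemma orthogonal_to_sums_iff_null_marginals:
  assumes f: "f \<in> Linf_on \<Sigma> P"
  shows "orthogonal_to_sums f \<longleftrightarrow> null_marginals f"
proof
  assume orth: "orthogonal_to_sums f"
  obtain f' c where f': "f' \<in> borel_measurable \<Sigma>" "AE z in P. f z = f' z" "c > 0" "\<And>z. \<bar>f' z\<bar> \<le> c"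
    using Linf_on_bounded_version[OF f] by blast
  have fP: "f \<in> borel_measurable P" "f' \<in> borel_measurable P"
    using f borel_measurable_\<Sigma>_P[OF f'(1)] unfolding Linf_on_def by auto
  have "(\<integral>z. f' z * indicator A (fst z) \<partial>P) = 0" if A: "A \<in> sets (invariant_algebra \<alpha>\<^sub>1)" for A
  proof -
    have "A \<in> sets borel" using A by (simp add: sets_invariant_algebra)
    have "(\<integral>z. f' z * indicator A (fst z) \<partial>P) = (\<integral>z. (indicator A (fst z) + 0) * f z \<partial>P)"
      using fP f'(2) \<open>A \<in> sets borel\<close>
      by (intro integral_cong_AE)
         (auto intro!: borel_measurable_times measurable_compose[OF fst_P])
    also have "\<dots> = 0"
      by (rule orth[unfolded orthogonal_to_sums_def, rule_format,
            OF indicator_in_L1_on[OF _ marginals(2) A] function_spaceD(1)[OF function_space_L1_on]])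
         (rule prob_space.axioms(1)[OF marginals(1)])
    finally show ?thesis .
  qed
  then have 1: "(\<integral>z. f' z * indicator B (fst z) \<partial>P) = 0" if "B \<in> sets borel" for B
    by (intro orthogonal_to_invariant_sets_imp_all_sets[OF lc act1 act fst_borel _ P_facts(1,2,5) f'(1,4,3) _ that]) auto
  have "(\<integral>z. f' z * indicator A (snd z) \<partial>P) = 0" if A: "A \<in> sets (invariant_algebra \<alpha>\<^sub>2)" for A
  proof -
    have "A \<in> sets borel" using A by (simp add: sets_invariant_algebra)
    have "(\<integral>z. f' z * indicator A (snd z) \<partial>P) = (\<integral>z. (0 + indicator A (snd z)) * f z \<partial>P)"
      using fP f'(2) \<open>A \<in> sets borel\<close>
      by (intro integral_cong_AE)
         (auto intro!: borel_measurable_times measurable_compose[OF snd_P])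
    also have "\<dots> = 0"
      by (rule orth[unfolded orthogonal_to_sums_def, rule_format,
            OF function_spaceD(1)[OF function_space_L1_on] indicator_in_L1_on[OF _ marginals(4) A]])
         (rule prob_space.axioms(1)[OF marginals(3)])
    finally show ?thesis .
  qed
  then have 2: "(\<integral>z. f' z * indicator B (snd z) \<partial>P) = 0" if "B \<in> sets borel" for B
    by (intro orthogonal_to_invariant_sets_imp_all_sets[OF lc act2 act snd_borel _ P_facts(1,2,5) f'(1,4,3) _ that]) auto
  have "null_marginals f'" using 1 2 unfolding null_marginals_def by auto
  then show "null_marginals f" using null_marginals_cong[OF fP f'(2)] by simp
next
  assume null: "null_marginals f"
  obtain C where fP: "f \<in> borel_measurable P" "AE z in P. \<bar>f z\<bar> \<le> C"
    using f unfolding Linf_on_def by auto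
  show "orthogonal_to_sums f"
    unfolding orthogonal_to_sums_def
  proof (intro ballI)
    fix g1 g2 assume g: "g1 \<in> L1_on (invariant_algebra \<alpha>\<^sub>1) P\<^sub>1" "g2 \<in> L1_on (invariant_algebra \<alpha>\<^sub>2) P\<^sub>2"
    have int: "integrable P (\<lambda>z. g1 (fst z))" "integrable P (\<lambda>z. g2 (snd z))"
      using L1_on_fst[OF g(1)] L1_on_snd[OF g(2)] unfolding L1_on_def by auto
    have "integrable P\<^sub>1 g1" "integrable P\<^sub>2 g2" using g unfolding L1_on_def by auto
    then have meas: "g1 \<in> borel_measurable borel" "g2 \<in> borel_measurable borel"
      using measurable_cong_sets[OF marginals(2) refl] measurable_cong_sets[OF marginals(4) refl]
      by (auto dest!: borel_measurable_integrable)
    have "(\<integral>z. (g1 (fst z) + g2 (snd z)) * f z \<partial>P) = (\<integral>z. g1 (fst z) * f z \<partial>P) + (\<integral>z. g2 (snd z) * f z \<partial>P)"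
      unfolding distrib_right
      by (intro Bochner_Integration.integral_add integrable_mult_AE_bounded[OF fP] int)
    also have "(\<integral>z. g1 (fst z) * f z \<partial>P) = 0"
      using null unfolding null_marginals_def
      by (intro integral_mult_compose_eq_0[OF fst_P fP _ meas(1) int(1)]) auto
    also have "(\<integral>z. g2 (snd z) * f z \<partial>P) = 0"
      using null unfolding null_marginals_def
      by (intro integral_mult_compose_eq_0[OF snd_P fP _ meas(2) int(2)]) auto
    finally show "(\<integral>z. (g1 (fst z) + g2 (snd z)) * f z \<partial>P) = 0" by simp
  qed
qed

lemma perturbed_in_invariant_couplings:
  assumes f: "f \<in> borel_measurable \<Sigma>" "\<And>z. \<bar>f z\<bar> \<le> c" "c > 0" and null: "null_marginals f"
  shows "perturbed f c \<in> \<Lambda>"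
proof -
  have fP: "f \<in> borel_measurable P" using f(1) by (rule borel_measurable_\<Sigma>_P)
  note mass = perturbed_mass(1)[OF fP f(2,3)]
  have sets: "sets (perturbed f c) = sets borel" by (simp add: P_facts(2))
  have image: "distr (perturbed f c) borel \<pi> = distr P borel \<pi>"
    if \<pi>: "\<pi> \<in> P \<rightarrow>\<^sub>M borel" and 0: "\<And>B. B \<in> sets borel \<Longrightarrow> (\<integral>z. f z * indicator B (\<pi> z) \<partial>P) = 0"
    for \<pi> :: "'a \<times> 'b \<Rightarrow> 'x::topological_space"
  proof (rule measure_eqI)
    fix B assume "B \<in> sets (distr (perturbed f c) borel \<pi>)"
    then have B: "B \<in> sets borel" by simp
    have B': "\<pi> -` B \<in> sets P" using measurable_sets[OF \<pi> B] by (simp add: space_P)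
    have "(indicator (\<pi> -` B) :: _ \<Rightarrow> real) = (\<lambda>z. indicator B (\<pi> z))"
      by (auto simp: fun_eq_iff split: split_indicator)
    moreover have "\<pi> \<in> perturbed f c \<rightarrow>\<^sub>M borel"
      using \<pi> by (simp add: measurable_cong_sets[OF sets_perturbed refl])
    ultimately show "emeasure (distr (perturbed f c) borel \<pi>) B = emeasure (distr P borel \<pi>) B"
      using mass[OF B'] 0[OF B] by (simp add: emeasure_distr[OF _ B] \<pi> space_P emeasure_eq_measure)
  qed simp
  have "prob_space (perturbed f c)"
  proof
    have "(\<integral>z. f z \<partial>P) = 0"
      using null unfolding null_marginals_def by (auto dest: bspec[of _ _ UNIV])
    then show "emeasure (perturbed f c) (space (perturbed f c)) = 1"
      using mass[of UNIV] prob_space sets.top[of P] by (simp add: space_P)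
  qed
  moreover have "invariant_measure \<delta> (perturbed f c)"
    unfolding perturbed_def using f(1)
    by (intro invariant_measure_density measurable_actionD(4)[OF act] P_facts(2,5)) auto
  ultimately show ?thesis
    using image[OF fst_P] image[OF snd_P] null sets P_facts(3,4)
    unfolding invariant_couplings_def couplings_def null_marginals_def by auto
qed

text \<open>
  \<open>P\<close> is the midpoint of its perturbations in the directions \<open>f\<close> and \<open>- f\<close>. These must coincide, so \<open>f\<close>
  has zero integral over every set.
\<close>

lemma extreme_imp_null_marginals_trivial:
  assumes ext: "extreme_measure_of P \<Lambda>" and f: "f \<in> Linf_on \<Sigma> P" and null: "null_marginals f"
  shows "AE z in P. f z = 0"
proof -
  obtain f' c where f': "f' \<in> borel_measurable \<Sigma>" "AE z in P. f z = f' z" "c > 0" "\<And>z. \<bar>f' z\<bar> \<le> c"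
    using Linf_on_bounded_version[OF f] by blast
  have fP: "f \<in> borel_measurable P" "f' \<in> borel_measurable P"
    using f borel_measurable_\<Sigma>_P[OF f'(1)] unfolding Linf_on_def by auto
  have null': "null_marginals f'" using null null_marginals_cong[OF fP f'(2)] by simp
  then have null'': "null_marginals (\<lambda>z. - f' z)" unfolding null_marginals_def by simp
  let ?Q = "perturbed f' c" and ?R = "perturbed (\<lambda>z. - f' z) c"
  have Q: "?Q \<in> \<Lambda>" using f' null' by (intro perturbed_in_invariant_couplings) auto
  have R: "?R \<in> \<Lambda>" using f' null'' by (intro perturbed_in_invariant_couplings) auto
  have mQ: "measure ?Q A = measure P A + (\<integral>z. f' z * indicator A z \<partial>P) / c" if "A \<in> sets P" for A
    using perturbed_mass[OF fP(2) f'(4,3) that] by (simp add: measure_def)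
  have mR: "measure ?R A = measure P A - (\<integral>z. f' z * indicator A z \<partial>P) / c" if "A \<in> sets P" for A
    using perturbed_mass[of "\<lambda>z. - f' z" c A] fP(2) f'(3,4) that by (simp add: measure_def)
  have "?Q = ?R"
  proof (rule ccontr)
    assume "?Q \<noteq> ?R"
    moreover have "measure P A = (1 - 1/2) * measure ?Q A + 1/2 * measure ?R A" if "A \<in> sets P" for A
      using mQ[OF that] mR[OF that] by (simp add: algebra_simps)
    moreover have "(0::real) < 1/2" "(1/2::real) < 1" by simp_all
    ultimately show False using ext Q R unfolding extreme_measure_of_def by metis
  qed
  then have 0: "(\<integral>z. f' z * indicator A z \<partial>P) = 0" if "A \<in> sets P" for A
    using mQ[OF that] mR[OF that] f'(3) by (simp add: field_simps)
  have "AE z in P. f' z = 0"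
    using 0 fP(2) f'(3,4) by (intro density_unique_real integrable_AE_bounded[of _ c])
      (auto simp: set_lebesgue_integral_def mult.commute)
  then show ?thesis using f'(2) by eventually_elim simp
qed

text \<open>
  From a proper convex decomposition of \<open>P\<close> with \<open>Q\<close> as one of its members, the density \<open>h\<close> of \<open>Q\<close> is
  bounded and can be chosen invariant, and \<open>h - 1\<close> has null marginals. So \<open>h = 1\<close> almost everywhere,
  whence \<open>Q = P\<close>, and then the other member equals \<open>P\<close> too.
\<close>

lemma null_marginals_trivial_imp_extreme:
  assumes trivial: "\<And>f. f \<in> Linf_on \<Sigma> P \<Longrightarrow> null_marginals f \<Longrightarrow> AE z in P. f z = 0"
  shows "extreme_measure_of P \<Lambda>"
proof (rule ccontr)
  assume "\<not> ?thesis"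
  then obtain Q R t where Q: "Q \<in> \<Lambda>" and R: "R \<in> \<Lambda>" and ne: "Q \<noteq> R" and t: "0 < t" "t < 1"
    and conv: "\<And>A. A \<in> sets P \<Longrightarrow> measure P A = (1 - t) * measure Q A + t * measure R A"
    using P unfolding extreme_measure_of_def by blast
  note Q_facts = invariant_couplingsD[OF Q] and R_facts = invariant_couplingsD[OF R]
  interpret Q: prob_space Q by (rule Q_facts(1))
  interpret R: prob_space R by (rule R_facts(1))
  (* Dropping the contribution of R to the convex combination gives Q \<le> k P. *)
  define k where "k = 1 / (1 - t)"
  have "k > 0" using t by (simp add: k_def)
  have Q_le: "measure Q A \<le> k * measure P A" if "A \<in> sets P" for A
    using conv[OF that] t by (simp add: k_def field_simps)
  have "absolutely_continuous P Q"
    unfolding absolutely_continuous_def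
  proof
    fix A assume "A \<in> null_sets P"
    then have A: "A \<in> sets P" "measure P A = 0" by (auto simp: measure_def)
    then have "measure Q A = 0" using Q_le[OF A(1)] by (simp add: measure_le_0_iff)
    then show "A \<in> null_sets Q" using A(1) P_facts(2) Q_facts(2) by (auto simp: null_sets_def Q.emeasure_eq_measure)
  qed
  then obtain h where h: "h \<in> borel_measurable \<Sigma>" "\<And>z. 0 \<le> h z" "Q = density P (\<lambda>z. ennreal (h z))"
    using invariant_density_exists[OF lc act finite_measure_axioms P_facts(2,5)
        Q.finite_measure_axioms Q_facts(2,5)] by blast
  have hP: "h \<in> borel_measurable P" using h(1) by (rule borel_measurable_\<Sigma>_P)
  have h_int: "integrable P h"
    using Q.emeasure_space_1 hP h(2) unfolding h(3)
    by (intro integrableI_nonneg) (auto simp: emeasure_density cong: nn_integral_cong)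
  have int_h: "(\<integral>z. h z * indicator A z \<partial>P) = measure Q A" if A: "A \<in> sets P" for A
  proof -
    have "measure Q A = (\<integral>z. indicator A z \<partial>Q)" using A P_facts(2) Q_facts(2) by simp
    also have "\<dots> = (\<integral>z. h z * indicator A z \<partial>P)"
      unfolding h(3) using A hP h(2) by (subst integral_real_density) auto
    finally show ?thesis ..
  qed
  have h_le: "AE z in P. h z \<le> k"
    using int_h Q_le by (intro AE_le_const_of_set_integrals h_int) simp
  define f where "f z = h z - 1" for z
  have f: "f \<in> Linf_on \<Sigma> P"
  proof -
    have "AE z in P. \<bar>f z\<bar> \<le> k + 1"
      using h_le
    proof eventually_elim
      case (elim z)
      then show ?case using h(2)[of z] \<open>k > 0\<close> by (simp add: f_def abs_le_iff)
    qed
    moreover have "f \<in> borel_measurable \<Sigma>" unfolding f_def using h(1) by measurable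
    ultimately show ?thesis
      using borel_measurable_\<Sigma>_P unfolding Linf_on_def by blast
  qed
  have null: "(\<integral>z. f z * indicator B (\<pi> z) \<partial>P) = 0"
    if \<pi>: "\<pi> \<in> P \<rightarrow>\<^sub>M borel" and eq: "distr Q borel \<pi> = distr P borel \<pi>" and B: "B \<in> sets borel"
    for \<pi> :: "'a \<times> 'b \<Rightarrow> 'x::topological_space" and B
  proof -
    have B': "\<pi> -` B \<in> sets P" using measurable_sets[OF \<pi> B] by (simp add: space_P)
    have "measure Q (\<pi> -` B) = measure (distr Q borel \<pi>) B"
      using \<pi> P_facts(2) Q_facts(2) B sets_eq_imp_space_eq[OF Q_facts(2)]
      by (subst measure_distr) (auto cong: measurable_cong_sets)
    also have "\<dots> = measure P (\<pi> -` B)"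
      unfolding eq using \<pi> B by (simp add: measure_distr space_P)
    finally have "measure Q (\<pi> -` B) = measure P (\<pi> -` B)" .
    moreover have "(\<integral>z. f z * indicator B (\<pi> z) \<partial>P)
        = (\<integral>z. h z * indicator (\<pi> -` B) z - indicator (\<pi> -` B) z \<partial>P)"
      by (intro Bochner_Integration.integral_cong) (auto simp: f_def split: split_indicator)
    moreover have "\<dots> = (\<integral>z. h z * indicator (\<pi> -` B) z \<partial>P) - measure P (\<pi> -` B)"
      using B' h_int by (subst Bochner_Integration.integral_diff)
        (auto intro!: integrable_real_mult_indicator simp: emeasure_eq_measure)
    ultimately show ?thesis using int_h[OF B'] by simp
  qed
  have "null_marginals f"
    unfolding null_marginals_def
    using null[OF fst_P] null[OF snd_P] P_facts(3,4) Q_facts(3,4) by auto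
  with f have "AE z in P. f z = 0" by (rule trivial)
  then have "AE z in P. h z = 1" by eventually_elim (simp add: f_def)
  then have "Q = density P (\<lambda>z. 1)"
    unfolding h(3) using hP by (intro density_cong) auto
  then have "Q = P" by (simp add: density_1)
  have "R = P"
  proof (rule measure_eqI)
    show "sets R = sets P" using P_facts(2) R_facts(2) by simp
    fix A assume "A \<in> sets R"
    then have "measure P A = (1 - t) * measure P A + t * measure R A"
      using conv P_facts(2) R_facts(2) \<open>Q = P\<close> by simp
    then have "t * measure R A = t * measure P A" unfolding left_diff_distrib by linarith
    then show "emeasure R A = emeasure P A"
      using t by (simp add: R.emeasure_eq_measure emeasure_eq_measure)
  qed
  then show False using ne \<open>Q = P\<close> by simp
qed

lemma extreme_iff_null_marginals_trivial:
  "extreme_measure_of P \<Lambda> \<longleftrightarrow>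
    \<not> (\<exists>f\<in>Linf_on \<Sigma> P. \<not> (AE z in P. f z = 0) \<and> null_marginals f)"
  using extreme_imp_null_marginals_trivial null_marginals_trivial_imp_extreme by blast

text \<open>
  If \<open>d\<close> is one of the sums, then the integral of \<open>f\<^sup>2\<close> is that of \<open>(f - d) f\<close>, which is at most
  a constant times the \<open>L\<^sub>1\<close> distance of \<open>f\<close> and \<open>d\<close>.
\<close>

lemma dense_imp_orthogonal_trivial:
  assumes dense: "L1_dense_in P invariant_sums (L1_on \<Sigma> P)"
    and f: "f \<in> Linf_on \<Sigma> P" and orth: "orthogonal_to_sums f"
  shows "AE z in P. f z = 0"
proof -
  obtain C f' where fP: "f \<in> borel_measurable P" "AE z in P. \<bar>f z\<bar> \<le> C"
    and f': "f' \<in> borel_measurable \<Sigma>" "AE z in P. f z = f' z"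
    using f unfolding Linf_on_def by auto
  define c where "c = \<bar>C\<bar> + 1"
  have c: "c > 0" and f_le: "AE z in P. \<bar>f z\<bar> \<le> c"
    using fP(2) by (auto simp: c_def elim!: eventually_mono)
  have f_int: "integrable P f" by (rule integrable_AE_bounded[OF fP])
  then have "f \<in> L1_on \<Sigma> P" using f' unfolding L1_on_def by blast
  have ff_int: "integrable P (\<lambda>z. f z * f z)" by (rule integrable_mult_AE_bounded[OF fP f_int])
  have "(\<integral>z. f z * f z \<partial>P) \<le> c * e" if e: "e > 0" for e
  proof -
    obtain d where d: "d \<in> invariant_sums" "(\<integral>z. \<bar>f z - d z\<bar> \<partial>P) < e"
      using dense \<open>f \<in> L1_on \<Sigma> P\<close> e unfolding L1_dense_in_def by blast
    have d_int: "integrable P d" using d(1) invariant_sums_subset unfolding L1_on_def by auto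
    have "(\<integral>z. d z * f z \<partial>P) = 0"
      using d(1) orth unfolding invariant_sums_iff orthogonal_to_sums_def by blast
    then have "(\<integral>z. f z * f z \<partial>P) = (\<integral>z. f z * f z \<partial>P) - (\<integral>z. d z * f z \<partial>P)" by simp
    also have "\<dots> = (\<integral>z. f z * f z - d z * f z \<partial>P)"
      by (intro Bochner_Integration.integral_diff[symmetric] integrable_mult_AE_bounded[OF fP] f_int d_int)
    also have "\<dots> \<le> (\<integral>z. c * \<bar>f z - d z\<bar> \<partial>P)"
    proof (rule integral_mono_AE)
      show "integrable P (\<lambda>z. f z * f z - d z * f z)"
        by (intro Bochner_Integration.integrable_diff integrable_mult_AE_bounded[OF fP] f_int d_int)
      show "AE z in P. f z * f z - d z * f z \<le> c * \<bar>f z - d z\<bar>"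
        using f_le
      proof eventually_elim
        case (elim z)
        have "f z * f z - d z * f z = f z * (f z - d z)" by (simp add: algebra_simps)
        also have "\<dots> \<le> \<bar>f z\<bar> * \<bar>f z - d z\<bar>" by (metis abs_ge_self abs_mult)
        also have "\<dots> \<le> c * \<bar>f z - d z\<bar>" using elim by (intro mult_right_mono) auto
        finally show ?case .
      qed
    qed (use f_int d_int in auto)
    also have "\<dots> = c * (\<integral>z. \<bar>f z - d z\<bar> \<partial>P)" by simp
    also have "\<dots> \<le> c * e" using d(2) c by (intro mult_left_mono) auto
    finally show ?thesis .
  qed
  from this[of "_ / c"] have "(\<integral>z. f z * f z \<partial>P) \<le> e" if "e > 0" for e
    using c that by (metis divide_pos_pos nonzero_mult_div_cancel_left less_irrefl times_divide_eq_right)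
  then have "(\<integral>z. f z * f z \<partial>P) \<le> 0 + e" if "e > 0" for e using that by simp
  then have "(\<integral>z. f z * f z \<partial>P) \<le> 0" by (rule field_le_epsilon)
  then have "(\<integral>z. f z * f z \<partial>P) = 0" by (intro antisym integral_nonneg_AE) auto
  then have "AE z in P. f z * f z = 0" using ff_int by (subst (asm) integral_nonneg_eq_0_iff_AE) auto
  then show ?thesis by eventually_elim simp
qed

text \<open>
  A function \<open>f0\<close> at positive distance from the sums is separated from them by a bounded function. Its
  conditional expectation given the invariant \<open>\<sigma>\<close>-algebra is still orthogonal to the sums, and still not
  orthogonal to \<open>f0\<close>, as all these functions have invariant versions.
\<close>

lemma orthogonal_trivial_imp_dense:
  assumes trivial: "\<And>f. f \<in> Linf_on \<Sigma> P \<Longrightarrow> orthogonal_to_sums f \<Longrightarrow> AE z in P. f z = 0"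
  shows "L1_dense_in P invariant_sums (L1_on \<Sigma> P)"
  unfolding L1_dense_in_def
proof (intro conjI invariant_sums_subset ballI allI impI, rule ccontr)
  fix f0 and e :: real assume f0: "f0 \<in> L1_on \<Sigma> P" and e: "e > 0"
  assume "\<not> (\<exists>d\<in>invariant_sums. (\<integral>z. \<bar>f0 z - d z\<bar> \<partial>P) < e)"
  then have far: "\<And>d. d \<in> invariant_sums \<Longrightarrow> e \<le> (\<integral>z. \<bar>f0 z - d z\<bar> \<partial>P)" by (auto simp: not_less)
  have int: "d \<in> L1_on \<Sigma> P \<Longrightarrow> integrable P d" for d unfolding L1_on_def by auto
  obtain \<phi> where \<phi>: "\<phi> \<in> borel_measurable P" "AE z in P. \<bar>\<phi> z\<bar> \<le> 1"
    "\<And>d. d \<in> invariant_sums \<Longrightarrow> (\<integral>z. \<phi> z * d z \<partial>P) = 0" "(\<integral>z. \<phi> z * f0 z \<partial>P) \<noteq> 0"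
    using L1_annihilator_exists[OF finite_measure_axioms function_space_invariant_sums _ int[OF f0] e far]
      int invariant_sums_subset by blast
  interpret sub: finite_measure_subalgebra P \<Sigma> using subalgebra_\<Sigma> by unfold_locales
  define f where "f = real_cond_exp P \<Sigma> \<phi>"
  have \<phi>_int: "integrable P \<phi>" by (rule integrable_AE_bounded[OF \<phi>(1,2)])
  have f_\<Sigma>: "f \<in> borel_measurable \<Sigma>" unfolding f_def by simp
  then have fP: "f \<in> borel_measurable P" by (rule borel_measurable_\<Sigma>_P)
  have f_le: "AE z in P. \<bar>f z\<bar> \<le> 1"
  proof -
    have "AE z in P. - 1 \<le> f z"
      unfolding f_def by (rule sub.real_cond_exp_ge_c[OF \<phi>_int]) (use \<phi>(2) in \<open>auto elim!: eventually_mono\<close>)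
    moreover have "AE z in P. f z \<le> 1"
      unfolding f_def by (rule sub.real_cond_exp_le_c[OF \<phi>_int]) (use \<phi>(2) in \<open>auto elim!: eventually_mono\<close>)
    ultimately show ?thesis by eventually_elim auto
  qed
  have same: "(\<integral>z. d z * f z \<partial>P) = (\<integral>z. \<phi> z * d z \<partial>P)" if d: "d \<in> L1_on \<Sigma> P" for d
  proof -
    obtain d' where d': "integrable P d" "d' \<in> borel_measurable \<Sigma>" "AE z in P. d z = d' z"
      using d unfolding L1_on_def by auto
    have d'P: "d' \<in> borel_measurable P" using d'(2) by (rule borel_measurable_\<Sigma>_P)
    have "integrable P d'"
      using d'(1) d'P d'(3) by (metis integrable_cong_AE borel_measurable_integrable)
    have "(\<integral>z. d z * f z \<partial>P) = (\<integral>z. d' z * f z \<partial>P)"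
      using d' d'P fP by (intro integral_cong_AE) auto
    also have "\<dots> = (\<integral>z. d' z * \<phi> z \<partial>P)"
      unfolding f_def using d'(2) \<phi>(1)
      by (intro sub.real_cond_exp_intg(2) integrable_mult_AE_bounded[OF \<phi>(1,2)] \<open>integrable P d'\<close>)
    also have "\<dots> = (\<integral>z. \<phi> z * d z \<partial>P)"
      using d' d'P \<phi>(1) by (intro integral_cong_AE) auto
    finally show ?thesis .
  qed
  have "f \<in> Linf_on \<Sigma> P" unfolding Linf_on_def using fP f_le f_\<Sigma> by blast
  moreover have "orthogonal_to_sums f"
    unfolding orthogonal_to_sums_def
  proof (intro ballI)
    fix g1 g2 assume "g1 \<in> L1_on (invariant_algebra \<alpha>\<^sub>1) P\<^sub>1" "g2 \<in> L1_on (invariant_algebra \<alpha>\<^sub>2) P\<^sub>2"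
    then have "(\<lambda>z. g1 (fst z) + g2 (snd z)) \<in> invariant_sums" unfolding invariant_sums_iff by blast
    then show "(\<integral>z. (g1 (fst z) + g2 (snd z)) * f z \<partial>P) = 0"
      using same \<phi>(3) invariant_sums_subset by auto
  qed
  ultimately have "AE z in P. f z = 0" by (rule trivial)
  then have "(\<integral>z. f0 z * f z \<partial>P) = 0" by (intro integral_eq_zero_AE) (auto elim!: eventually_mono)
  then show False using same[OF f0] \<phi>(4) by simp
qed

lemma cond_exp_iff_null_marginals:
  fixes M :: "'w measure" and \<xi>\<^sub>1 :: "'w \<Rightarrow> 'a" and \<xi>\<^sub>2 :: "'w \<Rightarrow> 'b"
  assumes "prob_space M" and \<xi>: "\<xi>\<^sub>1 \<in> M \<rightarrow>\<^sub>M borel" "\<xi>\<^sub>2 \<in> M \<rightarrow>\<^sub>M borel"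
    and law: "distr M borel (\<lambda>w. (\<xi>\<^sub>1 w, \<xi>\<^sub>2 w)) = P"
    and f: "f \<in> Linf_on \<Sigma> P"
  shows "((AE w in M. real_cond_exp M (vimage_algebra (space M) \<xi>\<^sub>1 borel) (\<lambda>w. f (\<xi>\<^sub>1 w, \<xi>\<^sub>2 w)) w = 0) \<and>
      (AE w in M. real_cond_exp M (vimage_algebra (space M) \<xi>\<^sub>2 borel) (\<lambda>w. f (\<xi>\<^sub>1 w, \<xi>\<^sub>2 w)) w = 0))
    \<longleftrightarrow> null_marginals f"
proof -
  interpret M: prob_space M by fact
  have pair: "(\<lambda>w. (\<xi>\<^sub>1 w, \<xi>\<^sub>2 w)) \<in> M \<rightarrow>\<^sub>M borel"
    using \<xi> unfolding borel_prod[symmetric] by (rule measurable_Pair)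
  obtain C where fP: "f \<in> borel_measurable P" "AE z in P. \<bar>f z\<bar> \<le> C"
    using f unfolding Linf_on_def by auto
  have f_int: "integrable M (\<lambda>w. f (\<xi>\<^sub>1 w, \<xi>\<^sub>2 w))"
    using integrable_AE_bounded[OF fP] unfolding law[symmetric] by (rule integrable_distr[OF pair])
  have f_borel: "f \<in> borel_measurable borel"
    using fP(1) by (simp add: measurable_cong_sets[OF P_facts(2) refl])
  have transfer: "(\<integral>w. f (\<xi>\<^sub>1 w, \<xi>\<^sub>2 w) * indicator B (\<pi> (\<xi>\<^sub>1 w, \<xi>\<^sub>2 w)) \<partial>M) = (\<integral>z. f z * indicator B (\<pi> z) \<partial>P)"
    if "\<pi> \<in> borel \<rightarrow>\<^sub>M borel" "B \<in> sets borel" for \<pi> :: "'a \<times> 'b \<Rightarrow> 'x::topological_space" and B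
    unfolding law[symmetric] using f_borel that
    by (intro integral_distr[symmetric, OF pair] borel_measurable_times measurable_compose[OF that(1)]) auto
  show ?thesis
    unfolding null_marginals_def M.integral_mult_eq_0_iff_cond_exp_eq_0[OF \<xi>(1) f_int]
      M.integral_mult_eq_0_iff_cond_exp_eq_0[OF \<xi>(2) f_int]
    using transfer[OF fst_borel] transfer[OF snd_borel] by simp
qed

end

theorem theorem30:
  fixes \<alpha>\<^sub>1 :: "'g::{topological_group_add, polish_space} \<Rightarrow> 'a::polish_space \<Rightarrow> 'a"
    and \<alpha>\<^sub>2 :: "'g \<Rightarrow> 'b::polish_space \<Rightarrow> 'b"
    and P\<^sub>1 :: "'a measure" and P\<^sub>2 :: "'b measure" and P :: "('a \<times> 'b) measure"
    and M :: "'w measure" and \<xi>\<^sub>1 :: "'w \<Rightarrow> 'a" and \<xi>\<^sub>2 :: "'w \<Rightarrow> 'b"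
  assumes "locally_compact_space (euclidean :: 'g topology)"
    and "measurable_action \<alpha>\<^sub>1" and "measurable_action \<alpha>\<^sub>2"
    and "prob_space P\<^sub>1" and "sets P\<^sub>1 = sets borel" and "invariant_measure \<alpha>\<^sub>1 P\<^sub>1"
    and "prob_space P\<^sub>2" and "sets P\<^sub>2 = sets borel" and "invariant_measure \<alpha>\<^sub>2 P\<^sub>2"
    and "P \<in> invariant_couplings \<alpha>\<^sub>1 \<alpha>\<^sub>2 P\<^sub>1 P\<^sub>2"
    and "prob_space M" and "\<xi>\<^sub>1 \<in> M \<rightarrow>\<^sub>M borel" and "\<xi>\<^sub>2 \<in> M \<rightarrow>\<^sub>M borel"
    and "distr M borel (\<lambda>w. (\<xi>\<^sub>1 w, \<xi>\<^sub>2 w)) = P"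
  shows "(extreme_measure_of P (invariant_couplings \<alpha>\<^sub>1 \<alpha>\<^sub>2 P\<^sub>1 P\<^sub>2) \<longleftrightarrow>
           L1_dense_in P
             {\<lambda>(x, y). g\<^sub>1 x + g\<^sub>2 y | g\<^sub>1 g\<^sub>2. g\<^sub>1 \<in> L1_on (invariant_algebra \<alpha>\<^sub>1) P\<^sub>1 \<and>
                g\<^sub>2 \<in> L1_on (invariant_algebra \<alpha>\<^sub>2) P\<^sub>2}
             (L1_on (invariant_algebra (diagonal_action \<alpha>\<^sub>1 \<alpha>\<^sub>2)) P))
       \<and> (extreme_measure_of P (invariant_couplings \<alpha>\<^sub>1 \<alpha>\<^sub>2 P\<^sub>1 P\<^sub>2) \<longleftrightarrow>
           \<not> (\<exists>f\<in>Linf_on (invariant_algebra (diagonal_action \<alpha>\<^sub>1 \<alpha>\<^sub>2)) P. \<not> (AE z in P. f z = 0) \<and>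
                (\<forall>g\<^sub>1\<in>L1_on (invariant_algebra \<alpha>\<^sub>1) P\<^sub>1. \<forall>g\<^sub>2\<in>L1_on (invariant_algebra \<alpha>\<^sub>2) P\<^sub>2.
                   (\<integral>z. (g\<^sub>1 (fst z) + g\<^sub>2 (snd z)) * f z \<partial>P) = 0)))
       \<and> (extreme_measure_of P (invariant_couplings \<alpha>\<^sub>1 \<alpha>\<^sub>2 P\<^sub>1 P\<^sub>2) \<longleftrightarrow>
           \<not> (\<exists>f\<in>Linf_on (invariant_algebra (diagonal_action \<alpha>\<^sub>1 \<alpha>\<^sub>2)) P. \<not> (AE z in P. f z = 0) \<and>
                (AE w in M. real_cond_exp M (vimage_algebra (space M) \<xi>\<^sub>1 borel)
                   (\<lambda>w. f (\<xi>\<^sub>1 w, \<xi>\<^sub>2 w)) w = 0) \<and>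
                (AE w in M. real_cond_exp M (vimage_algebra (space M) \<xi>\<^sub>2 borel)
                   (\<lambda>w. f (\<xi>\<^sub>1 w, \<xi>\<^sub>2 w)) w = 0)))"
proof -
  interpret invariant_coupling \<alpha>\<^sub>1 \<alpha>\<^sub>2 P\<^sub>1 P\<^sub>2 P
    using assms by unfold_locales
  have iii: "extreme_measure_of P \<Lambda> \<longleftrightarrow>
      \<not> (\<exists>f\<in>Linf_on \<Sigma> P. \<not> (AE z in P. f z = 0) \<and> orthogonal_to_sums f)"
    using orthogonal_to_sums_iff_null_marginals
    unfolding extreme_iff_null_marginals_trivial by blast
  have ii: "extreme_measure_of P \<Lambda> \<longleftrightarrow> L1_dense_in P invariant_sums (L1_on \<Sigma> P)"
    unfolding iii using dense_imp_orthogonal_trivial orthogonal_trivial_imp_dense by blast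
  have iv: "extreme_measure_of P \<Lambda> \<longleftrightarrow>
      \<not> (\<exists>f\<in>Linf_on \<Sigma> P. \<not> (AE z in P. f z = 0) \<and>
        (AE w in M. real_cond_exp M (vimage_algebra (space M) \<xi>\<^sub>1 borel) (\<lambda>w. f (\<xi>\<^sub>1 w, \<xi>\<^sub>2 w)) w = 0) \<and>
        (AE w in M. real_cond_exp M (vimage_algebra (space M) \<xi>\<^sub>2 borel) (\<lambda>w. f (\<xi>\<^sub>1 w, \<xi>\<^sub>2 w)) w = 0))"
    unfolding extreme_iff_null_marginals_trivial
    by (intro arg_cong[of _ _ Not] bex_cong refl) (simp only: cond_exp_iff_null_marginals[OF assms(11-14)])
  show ?thesis
    using ii iii iv unfolding invariant_sums_def orthogonal_to_sums_def by (intro conjI)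
qed

end
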